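(* Let $\varphi,\psi:V\to\mathbb R$ with $\psi|_{V_1}=0$, and define $f\in F(G)$ by $f(x)=m_x\psi(x)$ for $x\in V$ and $f(\langle x,y\rangle)=[\varphi(y)-\varphi(x)]e_{xy}$ for $\langle x,y\rangle\in E$. Suppose $f\in F_0(G)$ and let $(f_t)_{t\ge0}$ be the interacting particle system started from $f$. Then $$u(x,t)=\varphi(x)+\frac1{m_x}\mathbb E_f\Big(\int_0^t f_s(x)\,ds\Big),\qquad (x,t)\in V\times[0,\infty),$$ solves the Dirichlet initial-boundary value problem $$m_x\frac{d^2u}{dt^2}(x,t)=\sum_{y\in V}k_{xy}[u(y,t)-u(x,t)]\ \ ((x,t)\in V_0\times[0,\infty)),\quad u(x,0)=\varphi(x),\ \frac{du}{dt}(x,0)=\psi(x)\ (x\in V),\quad u(x,t)=\varphi(x)\ ((x,t)\in V_1\times[0,\infty)).$$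
   Context: A graph is a quadruple $G=(V,E,K,m)$: $V$ is a finite or countable set of nodes, which are elements of a real Hilbert space $\mathcal H$ with inner product "$\cdot$" and norm $|\cdot|$; $E$ is a set of undirected edges (at most one edge between any two distinct nodes, no self-loops); the edge between $x$ and $y$ is written $\langle x,y\rangle=\langle y,x\rangle$, and $y\sim x$ means this edge exists; $K=(k_{xy})_{x,y\in V}$ with $k_{xy}=k_{yx}\ge0$ and $k_{xy}=0$ if there is no edge; $m=(m_x)_{x\in V}$ with $m_x>0$. Let $e_{xy}=(y-x)/|y-x|$. Assume $d_0=\sup_{x\in V}\#\{y:y\sim x\}<\infty$, set $d=\max\{d_0,2\}$, and assume $M=\max\{\sup_{x\in V}m_x^{-1},\sup_{\langle x,y\rangle\in E}k_{xy}\}<\infty$. $V=V_0\cup V_1$ is a fixed partition into disjoint sets. $F(G)$ is the set of functions $f$ assigning a real number $f(x)$ to each $x\in V$ and a vector $f(\langle x,y\rangle)\in\mathcal H$ that is a real multiple of $y-x$ to each edge. For $1\le\alpha<\infty$, $\|f\|_\alpha=\big(\sum_{x\in V}|f(x)|^\alpha/m_x+\sum_{\langle x,y\rangle\in E}k_{xy}|f(\langle x,y\rangle)|^\alpha\big)^{1/\alpha}$, and $\|f\|_\infty=\max\{\sup_x|f(x)|,\sup_{\langle x,y\rangle}|f(\langle x,y\rangle)|\}$. $F_0(G)$ is the set of $f\in F(G)$ with finitely many nonzero values such that $|f(x)|\in\mathbb Z$ and $|f(\langle x,y\rangle)|\in\mathbb Z$ for all nodes and edges. The interacting particle system (IPS)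 $(f_t)_{t\ge0}$ is the continuous-time Markov jump process on $F_0(G)$ with the following transitions from state $f$: (i) for each $x\in V$, at rate $|f(x)|/m_x$, for every $y\sim x$ the edge value $f(\langle x,y\rangle)$ is replaced by $f(\langle x,y\rangle)+\mathrm{sgn}(f(x))\,e_{yx}$ (all other values unchanged); (ii) for each edge $\langle x,y\rangle$, at rate $k_{xy}|f(\langle x,y\rangle)|$, with $s=\mathrm{sgn}(f(\langle x,y\rangle)\cdot e_{xy})$, the value $f(x)$ is replaced by $f(x)+s$ if $x\in V_0$ and $f(y)$ by $f(y)-s$ if $y\in V_0$ (values at nodes of $V_1$ never change; this rule is symmetric in $x,y$). $P_f,\mathbb E_f$ denote probability and expectation given $f_0=f$. $\tau_0=0$, $\tau_n$ is the time of the $n$-th jump, $\xi_n=\tau_n-\tau_{n-1}$, $h_n=f_{\tau_n}$, and $\eta_t=\sup\{n:\tau_n\le t\}$. *)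

theory Defs
  imports "HOL-Probability.Probability"
begin

text \<open>
Graph G = (V,E,K,m). Nodes are points of a real inner product space 'a.
Undirected edges are represented as two-element sets {x,y}; E :: 'a set set.
K is a symmetric matrix k :: 'a => 'a => real, m :: 'a => real.
An element f of F(G) is a pair: node values (fst f :: 'a => real) and
edge values (snd f :: 'a set => 'a), where snd f {x,y} is the vector f(<x,y>).
\<close>

type_synonym 'a gfun = "('a \<Rightarrow> real) \<times> ('a set \<Rightarrow> 'a)"

definition edir :: "'a::real_normed_vector \<Rightarrow> 'a \<Rightarrow> 'a" where
  "edir x y = sgn (y - x)"

definition other :: "'a set \<Rightarrow> 'a \<Rightarrow> 'a" where
  "other e z = (THE w. w \<in> e \<and> w \<noteq> z)"

definition ek :: "('a \<Rightarrow> 'a \<Rightarrow> real) \<Rightarrow> 'a set \<Rightarrow> real" where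
  "ek k e = (THE r. \<exists>x y. e = {x, y} \<and> x \<noteq> y \<and> r = k x y)"

definition nbrs :: "'a set set \<Rightarrow> 'a \<Rightarrow> 'a set" where
  "nbrs E x = {y. {x, y} \<in> E}"

definition graph_ok ::
  "'a set \<Rightarrow> 'a set set \<Rightarrow> ('a \<Rightarrow> 'a \<Rightarrow> real) \<Rightarrow> ('a \<Rightarrow> real) \<Rightarrow> 'a set \<Rightarrow> 'a set \<Rightarrow> bool" where
  "graph_ok V E k m V0 V1 \<longleftrightarrow>
     countable V \<and>
     (\<forall>e\<in>E. \<exists>x y. x \<in> V \<and> y \<in> V \<and> x \<noteq> y \<and> e = {x, y}) \<and>
     (\<forall>x y. k x y = k y x \<and> k x y \<ge> 0) \<and>
     (\<forall>x y. (x = y \<or> {x, y} \<notin> E) \<longrightarrow> k x y = 0) \<and>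
     (\<forall>x\<in>V. m x > 0) \<and>
     (\<exists>d0::nat. \<forall>x\<in>V. finite (nbrs E x) \<and> card (nbrs E x) \<le> d0) \<and>
     (\<exists>M::real. (\<forall>x\<in>V. 1 / m x \<le> M) \<and> (\<forall>x y. {x, y} \<in> E \<longrightarrow> k x y \<le> M)) \<and>
     V0 \<inter> V1 = {} \<and> V0 \<union> V1 = V"

definition in_F :: "'a::real_normed_vector set \<Rightarrow> 'a set set \<Rightarrow> 'a gfun \<Rightarrow> bool" where
  "in_F V E f \<longleftrightarrow>
     (\<forall>x. x \<notin> V \<longrightarrow> fst f x = 0) \<and>
     (\<forall>e. e \<notin> E \<longrightarrow> snd f e = 0) \<and>
     (\<forall>x y. {x, y} \<in> E \<longrightarrow> (\<exists>c::real. snd f {x, y} = c *\<^sub>R (y - x)))"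

definition in_F0 :: "'a::real_normed_vector set \<Rightarrow> 'a set set \<Rightarrow> 'a gfun \<Rightarrow> bool" where
  "in_F0 V E f \<longleftrightarrow> in_F V E f \<and>
     finite {x. fst f x \<noteq> 0} \<and> finite {e. snd f e \<noteq> 0} \<and>
     (\<forall>x. \<bar>fst f x\<bar> \<in> \<int>) \<and> (\<forall>e. norm (snd f e) \<in> \<int>)"

definition node_jump :: "'a::real_normed_vector set set \<Rightarrow> 'a gfun \<Rightarrow> 'a \<Rightarrow> 'a gfun" where
  "node_jump E f x =
     (fst f, \<lambda>e. if e \<in> E \<and> x \<in> e then snd f e + sgn (fst f x) *\<^sub>R edir (other e x) x
               else snd f e)"

definition edge_jump :: "'a::real_inner set \<Rightarrow> 'a gfun \<Rightarrow> 'a set \<Rightarrow> 'a gfun" where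
  "edge_jump V0 f e =
     (\<lambda>z. if z \<in> V0 \<and> z \<in> e then fst f z + sgn (snd f e \<bullet> edir z (other e z)) else fst f z,
      snd f)"

definition node_rate :: "'a set \<Rightarrow> ('a \<Rightarrow> real) \<Rightarrow> 'a gfun \<Rightarrow> 'a \<Rightarrow> real" where
  "node_rate V m f x = (if x \<in> V then \<bar>fst f x\<bar> / m x else 0)"

definition edge_rate :: "'a::real_normed_vector set set \<Rightarrow> ('a \<Rightarrow> 'a \<Rightarrow> real) \<Rightarrow> 'a gfun \<Rightarrow> 'a set \<Rightarrow> real" where
  "edge_rate E k f e = (if e \<in> E then ek k e * norm (snd f e) else 0)"

definition total_rate :: "'a::real_normed_vector set \<Rightarrow> 'a set set \<Rightarrow> ('a \<Rightarrow> 'a \<Rightarrow> real) \<Rightarrow> ('a \<Rightarrow> real) \<Rightarrow> 'a gfun \<Rightarrow> real" where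
  "total_rate V E k m f =
     (\<Sum>x\<in>{x\<in>V. fst f x \<noteq> 0}. node_rate V m f x) + (\<Sum>e\<in>{e\<in>E. snd f e \<noteq> 0}. edge_rate E k f e)"

definition jump_prob ::
  "'a::real_inner set \<Rightarrow> 'a set set \<Rightarrow> ('a \<Rightarrow> 'a \<Rightarrow> real) \<Rightarrow> ('a \<Rightarrow> real) \<Rightarrow> 'a set \<Rightarrow>
   'a gfun \<Rightarrow> 'a gfun \<Rightarrow> real" where
  "jump_prob V E k m V0 f g =
     (if total_rate V E k m f = 0 then (if g = f then 1 else 0)
      else ((\<Sum>x\<in>{x\<in>V. fst f x \<noteq> 0 \<and> node_jump E f x = g}. node_rate V m f x)
          + (\<Sum>e\<in>{e\<in>E. snd f e \<noteq> 0 \<and> edge_jump V0 f e = g}. edge_rate E k f e))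
           / total_rate V E k m f)"

text \<open>
(M, h, xi) realises the IPS started at f0: h n = h_n is the embedded jump chain,
xi n = \<xi>_n the holding times (value \<infinity> allowed when the state is absorbing);
their joint law is specified by its finite-dimensional distributions:
P(h_0=g_0,...,h_n=g_n, \<xi>_1>s_1,...,\<xi>_n>s_n) = [g_0=f0] \<Prod> p(g_{i-1},g_i) exp(-q(g_{i-1}) s_i).
\<close>
definition ips_realization ::
  "'a::real_inner set \<Rightarrow> 'a set set \<Rightarrow> ('a \<Rightarrow> 'a \<Rightarrow> real) \<Rightarrow> ('a \<Rightarrow> real) \<Rightarrow> 'a set \<Rightarrow>
   'w measure \<Rightarrow> (nat \<Rightarrow> 'w \<Rightarrow> 'a gfun) \<Rightarrow> (nat \<Rightarrow> 'w \<Rightarrow> ereal) \<Rightarrow> 'a gfun \<Rightarrow> bool" where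
  "ips_realization V E k m V0 M h xi f0 \<longleftrightarrow>
     prob_space M \<and>
     (\<forall>n. h n \<in> measurable M (count_space UNIV)) \<and>
     (\<forall>n. xi n \<in> borel_measurable M) \<and>
     (\<forall>n (g::nat \<Rightarrow> 'a gfun) (s::nat \<Rightarrow> real). (\<forall>i. 0 \<le> s i) \<longrightarrow>
        measure M {\<omega> \<in> space M. (\<forall>i\<le>n. h i \<omega> = g i) \<and> (\<forall>i\<in>{1..n}. ereal (s i) < xi i \<omega>)}
        = (if g 0 = f0 then 1 else 0) *
          (\<Prod>i\<in>{1..n}. jump_prob V E k m V0 (g (i - 1)) (g i) *
                          exp (- total_rate V E k m (g (i - 1)) * s i)))"

text \<open>jump times \<tau>_n, and the state f_t = h_{\<eta>_t}, \<eta>_t = sup{n. \<tau>_n \<le> t}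
  (set to 0 on the explosion event, which has probability 0).\<close>
definition jump_time :: "(nat \<Rightarrow> 'w \<Rightarrow> ereal) \<Rightarrow> nat \<Rightarrow> 'w \<Rightarrow> ereal" where
  "jump_time xi n \<omega> = (\<Sum>i\<in>{1..n}. xi i \<omega>)"

definition ips_state :: "(nat \<Rightarrow> 'w \<Rightarrow> ('a::zero) gfun) \<Rightarrow> (nat \<Rightarrow> 'w \<Rightarrow> ereal) \<Rightarrow> real \<Rightarrow> 'w \<Rightarrow> 'a gfun" where
  "ips_state h xi t \<omega> =
     (let N = {n. jump_time xi n \<omega> \<le> ereal t} in
      if finite N then h (Max N) \<omega> else (\<lambda>_. 0, \<lambda>_. 0))"

definition ips_u ::
  "('a::zero \<Rightarrow> real) \<Rightarrow> ('a \<Rightarrow> real) \<Rightarrow> 'w measure \<Rightarrow> (nat \<Rightarrow> 'w \<Rightarrow> 'a gfun) \<Rightarrow> (nat \<Rightarrow> 'w \<Rightarrow> ereal) \<Rightarrow>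
   'a \<Rightarrow> real \<Rightarrow> real" where
  "ips_u \<phi> m M h xi x t =
     \<phi> x + (1 / m x) * (\<integral>\<omega>. (LBINT s:{0..t}. fst (ips_state h xi s \<omega>) x) \<partial>M)"

end

theory Submission
  imports Defs
begin

text \<open>
The generator of the process acts linearly on the coordinate functionals: the drift of \<open>f(x)\<close> is
\<open>\<Sum>y. k x y * f(x,y)\<close> for \<open>x\<close> in \<open>V0\<close> (and zero on \<open>V1\<close>), where \<open>f(x,y)\<close> is the component of the edge value
along \<open>y - x\<close>, and the drift of \<open>f(x,y)\<close> is \<open>f(y) / m y - f(x) / m x\<close>. Dynkin's formula for these functionals
says that the expected edge value is \<open>u y - u x\<close> and that the expected node value \<open>m x * u' x\<close> has derivative
\<open>\<Sum>y. k x y * (u y - u x)\<close>, which is the wave equation.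

Dynkin's formula follows from the forward equations of the probabilities of \<open>h n = g\<close> and
\<open>\<tau> n \<le> t < \<tau> (n + 1)\<close>, summed over \<open>n\<close>. The rates are unbounded, so the tail of the sum is controlled by a
Lyapunov function: a jump increases the total mass \<open>W\<close> by a bounded amount and the rates are \<open>O(W)\<close>, hence the
drift of \<open>W\<^sup>2\<close> is \<open>O(W\<^sup>2)\<close> and the second moment grows at most exponentially.
\<close>

section \<open>Sums with an independent exponential variable\<close>

text \<open>The law is given only through events that fix the first \<open>n\<close> states and
  bound the holding times strictly from below; the distributions of the jump times have to be
  rebuilt from it. The state type need not be countable, but from a finitely supported state only
  finitely many states can occur after \<open>n\<close> jumps. At fixed \<open>n\<close> everything
  is therefore a finite sum, and the one infinite operation is the sum over \<open>n\<close>.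
  Truncating it at \<open>N\<close> leaves the expectation of \<open>G (h N)\<close> on
  \<open>\<tau> N \<le> t\<close>; that this remainder tends to zero is a weighted form of
  non-explosion. For \<open>G\<close> of order \<open>W\<close> the remainder is a time integral of
  a quantity of order \<open>W\<^sup>2\<close>, one factor from \<open>G\<close> and one from the
  rates, which is why a second moment is controlled. The drift is linear despite the absolute values
  and signs in the rules because a rate \<open>\<bar>a\<bar>\<close> times a jump
  \<open>sgn a\<close> is \<open>a\<close>.\<close>

lemma integral_has_derivative_Ici:
  fixes g :: "real \<Rightarrow> real"
  assumes "continuous_on {0..} g" "0 \<le> t"
  shows "((\<lambda>t. integral {0..t} g) has_real_derivative g t) (at t within {0..})"
proof -
  have "at t within {0..t+1} = at t within {0..}"
    by (rule at_within_nhd[of _ "{..<t+1}"]) (use assms(2) in auto)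
  moreover have "((\<lambda>t. integral {0..t} g) has_real_derivative g t) (at t within {0..t+1})"
    by (rule integral_has_real_derivative) (use assms in \<open>auto intro: continuous_on_subset\<close>)
  ultimately show ?thesis by simp
qed

lemma has_integral_derivative_Ici:
  fixes F :: "real \<Rightarrow> real"
  assumes "0 \<le> t" "\<And>s. 0 \<le> s \<Longrightarrow> (F has_real_derivative F' s) (at s within {0..})"
  shows "(F' has_integral F t - F 0) {0..t}"
proof (rule fundamental_theorem_of_calculus[OF assms(1)])
  fix s assume "s \<in> {0..t}"
  then have "(F has_real_derivative F' s) (at s within {0..t})"
    by (intro DERIV_subset[OF assms(2)]) auto
  then show "(F has_vector_derivative F' s) (at s within {0..t})"
    by (simp add: has_real_derivative_iff_has_vector_derivative)
qed

text \<open>The convolution of \<open>R\<close> with the exponential density of rate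
  \<open>q\<close>: if \<open>R\<close> is the distribution function of some
  \<open>X \<ge> 0\<close>, this is the one of \<open>X + Y\<close> with \<open>Y\<close>
  exponential and independent of \<open>X\<close>. Pulling \<open>exp (- q * t)\<close> out leaves
  an integrand free of \<open>t\<close>, so the product rule and the fundamental theorem suffice to
  differentiate. For \<open>q = 0\<close> it vanishes, as fits an infinite holding time.\<close>

definition exp_conv :: "real \<Rightarrow> (real \<Rightarrow> real) \<Rightarrow> real \<Rightarrow> real" where
  "exp_conv q R t = q * exp (- q * t) * integral {0..t} (\<lambda>u. exp (q * u) * R u)"

lemma exp_conv_cmult: "exp_conv q (\<lambda>u. R u * c) t = exp_conv q R t * c"
  unfolding exp_conv_def by (simp add: mult.assoc[symmetric])

lemma exp_conv_0 [simp]: "exp_conv q R 0 = 0"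
  by (simp add: exp_conv_def)

text \<open>With \<open>R\<close> for the arrival in a state and its convolution for the departure,
  the difference is the probability of being there, and departures occur at \<open>q\<close> times
  it.\<close>

lemma exp_conv_has_derivative:
  fixes R :: "real \<Rightarrow> real"
  assumes R: "continuous_on {0..} R" and t: "0 \<le> t"
  shows "(exp_conv q R has_real_derivative q * (R t - exp_conv q R t)) (at t within {0..})"
proof -
  have "continuous_on {0..} (\<lambda>u. exp (q * u) * R u)"
    by (intro continuous_intros R)
  from integral_has_derivative_Ici[OF this t]
  have "((\<lambda>t. integral {0..t} (\<lambda>u. exp (q * u) * R u)) has_real_derivative exp (q * t) * R t) (at t within {0..})" .
  then show ?thesis
    unfolding exp_conv_def[abs_def]
    by (auto intro!: derivative_eq_intros simp: exp_minus field_simps)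
qed

lemma exp_conv_continuous:
  assumes "continuous_on {0..} R"
  shows "continuous_on {0..} (exp_conv q R)"
  using exp_conv_has_derivative[OF assms]
  by (meson DERIV_continuous atLeast_iff continuous_on_eq_continuous_within)

text \<open>\<open>w\<close> is the integral of \<open>q * exp (q * u)\<close> over
  \<open>{a..b}\<close>, and a monotone \<open>R\<close> stays between its end values there. Up to
  the factor \<open>exp (- q * t)\<close> these are also the bounds for the probability of a
  strip.\<close>

lemma exp_kernel_integral_bounds:
  fixes R :: "real \<Rightarrow> real"
  assumes R: "continuous_on {0..} R" and mono: "\<And>x y. 0 \<le> x \<Longrightarrow> x \<le> y \<Longrightarrow> R x \<le> R y"
    and ab: "0 \<le> a" "a \<le> b" and q: "0 \<le> q"
  defines "w \<equiv> exp (q * b) - exp (q * a)"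
  shows "R a * w \<le> q * integral {a..b} (\<lambda>u. exp (q * u) * R u)"
    and "q * integral {a..b} (\<lambda>u. exp (q * u) * R u) \<le> R b * w"
proof -
  have i: "((\<lambda>u. q * exp (q * u)) has_integral w) {a..b}"
    unfolding w_def using ab(2)
    by (intro fundamental_theorem_of_calculus)
       (auto intro!: derivative_eq_intros simp flip: has_real_derivative_iff_has_vector_derivative)
  have int: "(\<lambda>u. exp (q * u) * R u) integrable_on {a..b}"
    by (intro integrable_continuous_interval continuous_intros continuous_on_subset[OF R]) (use ab in auto)
  have *: "((\<lambda>u. q * (exp (q * u) * R u)) has_integral q * integral {a..b} (\<lambda>u. exp (q * u) * R u)) {a..b}"
    using has_integral_mult_right[OF integrable_integral[OF int]] .
  show "R a * w \<le> q * integral {a..b} (\<lambda>u. exp (q * u) * R u)"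
    by (rule has_integral_le[OF has_integral_mult_right[OF i] *])
       (use mono ab q in \<open>auto simp: mult.left_commute intro!: mult_left_mono\<close>)
  show "q * integral {a..b} (\<lambda>u. exp (q * u) * R u) \<le> R b * w"
    by (rule has_integral_le[OF * has_integral_mult_right[OF i]])
       (use mono ab q in \<open>auto simp: mult.left_commute intro!: mult_left_mono\<close>)
qed

text \<open>Cutting the range of \<open>Y\<close> into strips of width \<open>\<delta>\<close> squeezes both sides between the same two sums, which
  differ by at most \<open>q * \<delta> * R t\<close>.\<close>

lemma (in finite_measure) measure_sum_exp_conv:
  fixes X Y :: "'a \<Rightarrow> ereal" and R :: "real \<Rightarrow> real"
  assumes [measurable]: "X \<in> borel_measurable M" "Y \<in> borel_measurable M" "A \<in> sets M"
    and X0: "AE \<omega> in M. 0 \<le> X \<omega>" and Y0: "AE \<omega> in M. 0 < Y \<omega>"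
    and q: "0 \<le> q" and R: "continuous_on {0..} R"
    and joint: "\<And>t s. 0 \<le> t \<Longrightarrow> 0 \<le> s \<Longrightarrow>
      measure M {\<omega> \<in> A. X \<omega> \<le> ereal t \<and> ereal s < Y \<omega>} = R t * exp (- q * s)"
    and t: "0 \<le> t"
  shows "measure M {\<omega> \<in> A. X \<omega> + Y \<omega> \<le> ereal t} = exp_conv q R t"
proof -
  have msr[measurable]: "{\<omega> \<in> A. P \<omega>} \<in> sets M" if "Measurable.pred M P" for P
  proof -
    have "{\<omega> \<in> A. P \<omega>} = A \<inter> {\<omega> \<in> space M. P \<omega>}"
      using sets.sets_into_space[OF assms(3)] by auto
    also have "\<dots> \<in> sets M" using that by measurable
    finally show ?thesis .
  qed
  \<comment> \<open>At \<open>s = 0\<close> the hypothesis exhibits \<open>R t\<close> as a measure,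
    which is where the monotonicity of \<open>R\<close> comes from.\<close>
  have R_eq: "R t = measure M {\<omega> \<in> A. X \<omega> \<le> ereal t \<and> 0 < Y \<omega>}" if "0 \<le> t" for t
    using joint[OF that, of 0] by (simp add: zero_ereal_def)
  have mono: "R x \<le> R y" if "0 \<le> x" "x \<le> y" for x y
  proof -
    have "0 \<le> y" using that by simp
    show ?thesis unfolding R_eq[OF that(1)] R_eq[OF \<open>0 \<le> y\<close>]
      by (intro finite_measure_mono) (use that in \<open>auto intro: order_trans\<close>)
  qed
  have strip: "measure M {\<omega> \<in> A. X \<omega> \<le> ereal x \<and> ereal a < Y \<omega> \<and> Y \<omega> \<le> ereal b}
      = R x * (exp (- (q * a)) - exp (- (q * b)))" if "0 \<le> x" "0 \<le> a" "a \<le> b" for x a b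
  proof -
    have "{\<omega> \<in> A. X \<omega> \<le> ereal x \<and> ereal a < Y \<omega> \<and> Y \<omega> \<le> ereal b} =
       {\<omega> \<in> A. X \<omega> \<le> ereal x \<and> ereal a < Y \<omega>} - {\<omega> \<in> A. X \<omega> \<le> ereal x \<and> ereal b < Y \<omega>}"
      by auto
    also have "measure M \<dots> = R x * exp (- (q * a)) - R x * exp (- (q * b))"
      using joint[of x a] joint[of x b] that
      by (subst finite_measure_Diff) (auto simp: intro: le_less_trans[of "ereal b"] elim: le_less_trans[rotated])
    finally show ?thesis by (simp add: algebra_simps)
  qed
  define J where "J b = measure M {\<omega> \<in> A. X \<omega> + Y \<omega> \<le> ereal t \<and> Y \<omega> \<le> ereal b}" for b
  \<comment> \<open>Substituting \<open>y = t - u\<close>, this is the part of the convolution with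
    the exponential variable in \<open>{0..b}\<close>, the counterpart of
    \<open>J b\<close>.\<close>
  define I where "I b = exp (- (q * t)) * (q * integral {t-b..t} (\<lambda>u. exp (q * u) * R u))" for b
  have step: "\<bar>(J b - J a) - (I b - I a)\<bar> \<le> q * (b - a) * (R (t - a) - R (t - b))"
    if ab: "0 \<le> a" "a \<le> b" "b \<le> t" for a b
  proof -
    define w where "w = exp (- (q * a)) - exp (- (q * b))"
    have "J b - J a = measure M ({\<omega> \<in> A. X \<omega> + Y \<omega> \<le> ereal t \<and> Y \<omega> \<le> ereal b}
         - {\<omega> \<in> A. X \<omega> + Y \<omega> \<le> ereal t \<and> Y \<omega> \<le> ereal a})"
      unfolding J_def using ab by (subst finite_measure_Diff) (auto elim: order_trans)
    also have "{\<omega> \<in> A. X \<omega> + Y \<omega> \<le> ereal t \<and> Y \<omega> \<le> ereal b} - {\<omega> \<in> A. X \<omega> + Y \<omega> \<le> ereal t \<and> Y \<omega> \<le> ereal a}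
       = {\<omega> \<in> A. X \<omega> + Y \<omega> \<le> ereal t \<and> ereal a < Y \<omega> \<and> Y \<omega> \<le> ereal b}" by auto
    finally have Jd: "J b - J a = measure M \<dots>" .
    \<comment> \<open>On the strip \<open>a < Y \<le> b\<close>, the condition
      \<open>X \<le> t - b\<close> forces \<open>X + Y \<le> t\<close>, which in turn forces
      \<open>X \<le> t - a\<close>. The increments of \<open>J\<close> and \<open>I\<close> are thus
      caught between the same two numbers.\<close>
    have J1: "R (t - b) * w \<le> J b - J a"
      unfolding Jd w_def strip[OF _ ab(1,2), of "t - b", symmetric, simplified, OF ab(3)]
    proof (intro finite_measure_mono)
      show "{\<omega> \<in> A. X \<omega> \<le> ereal (t - b) \<and> ereal a < Y \<omega> \<and> Y \<omega> \<le> ereal b}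
        \<subseteq> {\<omega> \<in> A. X \<omega> + Y \<omega> \<le> ereal t \<and> ereal a < Y \<omega> \<and> Y \<omega> \<le> ereal b}"
      proof safe
        fix \<omega> assume "X \<omega> \<le> ereal (t - b)" "Y \<omega> \<le> ereal b"
        from add_mono[OF this] show "X \<omega> + Y \<omega> \<le> ereal t" by simp
      qed
    qed measurable
    have J2: "J b - J a \<le> R (t - a) * w"
    proof -
      have "a \<le> t" using ab by simp
      then show ?thesis
      unfolding Jd w_def strip[OF _ ab(1,2), of "t - a", symmetric, simplified, OF \<open>a \<le> t\<close>]
    proof (intro finite_measure_mono)
      show "{\<omega> \<in> A. X \<omega> + Y \<omega> \<le> ereal t \<and> ereal a < Y \<omega> \<and> Y \<omega> \<le> ereal b}
        \<subseteq> {\<omega> \<in> A. X \<omega> \<le> ereal (t - a) \<and> ereal a < Y \<omega> \<and> Y \<omega> \<le> ereal b}"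
      proof safe
        fix \<omega> assume "X \<omega> + Y \<omega> \<le> ereal t" "ereal a < Y \<omega>" "Y \<omega> \<le> ereal b"
        then show "X \<omega> \<le> ereal (t - a)" by (cases "X \<omega>"; cases "Y \<omega>") auto
      qed
    qed measurable
    qed
    have int: "(\<lambda>u. exp (q * u) * R u) integrable_on {t-b..t}"
      by (intro integrable_continuous_interval continuous_intros continuous_on_subset[OF R]) (use ab in auto)
    have "I b - I a = exp (- (q * t)) * (q * integral {t-b..t-a} (\<lambda>u. exp (q * u) * R u))"
      unfolding I_def
      using Henstock_Kurzweil_Integration.integral_combine[OF _ _ int, of "t - a", symmetric] ab
      by (simp add: distrib_left)
    moreover have w: "w = exp (- (q * t)) * (exp (q * (t - a)) - exp (q * (t - b)))"
      unfolding w_def by (simp add: algebra_simps flip: exp_add)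
    ultimately have I12: "R (t - b) * w \<le> I b - I a" "I b - I a \<le> R (t - a) * w"
      using exp_kernel_integral_bounds[OF R mono _ _ q, of "t - b" "t - a"] ab
      by (auto simp: mult.left_commute)
    have "w = exp (- (q * a)) * (1 - exp (- (q * (b - a))))"
      by (simp add: w_def algebra_simps flip: exp_add)
    also have "\<dots> \<le> 1 * (q * (b - a))"
    proof (intro mult_mono)
      show "1 - exp (- (q * (b - a))) \<le> q * (b - a)"
        using exp_ge_add_one_self[of "- (q * (b - a))"] by linarith
    qed (use ab q in auto)
    finally have "w \<le> q * (b - a)" by simp
    have "\<bar>(J b - J a) - (I b - I a)\<bar> \<le> R (t - a) * w - R (t - b) * w"
      using J1 J2 I12 by linarith
    also have "\<dots> = w * (R (t - a) - R (t - b))" by (simp add: algebra_simps)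
    also have "\<dots> \<le> q * (b - a) * (R (t - a) - R (t - b))"
      using \<open>w \<le> _\<close> mono[of "t - b" "t - a"] ab by (intro mult_right_mono) auto
    finally show ?thesis .
  qed
  have J0: "J 0 = 0"
  proof -
    have "AE \<omega> in M. \<omega> \<notin> {\<omega> \<in> A. X \<omega> + Y \<omega> \<le> ereal t \<and> Y \<omega> \<le> ereal 0}"
      using Y0 by eventually_elim (auto simp: zero_ereal_def)
    then show ?thesis unfolding J_def
      by (subst measure_eq_0_null_sets) (auto simp: AE_iff_null_sets)
  qed
  \<comment> \<open>On a uniform partition the differences of \<open>R\<close> telescope, so the
    total error is at most the mesh times \<open>q * R t\<close>. Using \<open>Suc m\<close> pieces
    avoids a division by zero.\<close>
  have bound: "\<bar>J t - I t\<bar> \<le> q * t / real (Suc m) * R t" for m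
  proof -
    define \<delta> where "\<delta> = t / real (Suc m)"
    have \<delta>: "0 \<le> \<delta>" using t by (simp add: \<delta>_def)
    have "\<bar>J (real k * \<delta>) - I (real k * \<delta>)\<bar> \<le> q * \<delta> * (R t - R (t - real k * \<delta>))" if "k \<le> Suc m" for k
      using that
    proof (induction k)
      case 0
      then show ?case by (simp add: J0 I_def)
    next
      case (Suc k)
      have "real (Suc k) * \<delta> \<le> real (Suc m) * \<delta>" using Suc.prems \<delta> by (intro mult_right_mono) auto
      also have "\<dots> = t" by (simp add: \<delta>_def)
      finally have "\<bar>(J (real (Suc k) * \<delta>) - J (real k * \<delta>)) - (I (real (Suc k) * \<delta>) - I (real k * \<delta>))\<bar>
         \<le> q * (real (Suc k) * \<delta> - real k * \<delta>) * (R (t - real k * \<delta>) - R (t - real (Suc k) * \<delta>))"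
        using \<delta> by (intro step) (auto intro!: mult_right_mono)
      also have "real (Suc k) * \<delta> - real k * \<delta> = \<delta>" by (simp add: algebra_simps)
      finally show ?case using Suc.IH Suc.prems unfolding right_diff_distrib by linarith
    qed
    from this[of "Suc m"] have "\<bar>J t - I t\<bar> \<le> q * \<delta> * (R t - R 0)" by (simp add: \<delta>_def)
    also have "\<dots> \<le> q * \<delta> * R t"
      using q \<delta> R_eq[of 0] by (intro mult_left_mono) auto
    finally show ?thesis by (simp add: \<delta>_def)
  qed
  have "\<bar>J t - I t\<bar> \<le> 0"
  proof (rule LIMSEQ_le_const)
    show "(\<lambda>m. q * t / real (Suc m) * R t) \<longlonglongrightarrow> 0" 
      using tendsto_mult[OF LIMSEQ_inverse_real_of_nat tendsto_const[of "q * t * R t"]]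
      by (simp add: field_simps)
  qed (use bound in auto)
  then have "J t = I t" by simp
  also have "I t = exp_conv q R t" by (simp add: I_def exp_conv_def)
  also have "J t = measure M {\<omega> \<in> A. X \<omega> + Y \<omega> \<le> ereal t}"
    unfolding J_def
  proof (rule measure_eq_AE)
    show "AE \<omega> in M. \<omega> \<in> {\<omega> \<in> A. X \<omega> + Y \<omega> \<le> ereal t \<and> Y \<omega> \<le> ereal t} \<longleftrightarrow> \<omega> \<in> {\<omega> \<in> A. X \<omega> + Y \<omega> \<le> ereal t}"
      using X0
    proof eventually_elim
      case (elim \<omega>)
      have "Y \<omega> \<le> X \<omega> + Y \<omega>" using elim by (metis add.commute add_0 add_left_mono)
      then show ?case by auto
    qed
  qed measurable
  finally show ?thesis .
qed

section \<open>Occupation probabilities of a jump chain\<close>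

text \<open>By \<open>p_sum\<close> a jump from \<open>S n\<close> lands in the finite set
  \<open>S (Suc n)\<close> with probability one, so expectations at stage \<open>n\<close> are
  finite sums whatever the size of the state type.\<close>

locale jump_chain = prob_space M for M :: "'w measure" +
  fixes h :: "nat \<Rightarrow> 'w \<Rightarrow> 's" and xi :: "nat \<Rightarrow> 'w \<Rightarrow> ereal"
    and q :: "'s \<Rightarrow> real" and p :: "'s \<Rightarrow> 's \<Rightarrow> real" and S :: "nat \<Rightarrow> 's set" and f0 :: 's
  assumes h_measurable [measurable]: "\<And>n. h n \<in> measurable M (count_space UNIV)"
    and xi_measurable [measurable]: "\<And>n. xi n \<in> borel_measurable M"
    and q_nonneg: "\<And>g. 0 \<le> q g" and p_nonneg: "\<And>g g'. 0 \<le> p g g'"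
    and finite_S [simp]: "\<And>n. finite (S n)" and S_0: "S 0 = {f0}"
    and p_sum: "\<And>n g. g \<in> S n \<Longrightarrow> (\<Sum>g'\<in>S (Suc n). p g g') = 1"
    and fdd: "\<And>n g s. (\<And>i. 0 \<le> s i) \<Longrightarrow>
      measure M {\<omega> \<in> space M. (\<forall>i\<le>n. h i \<omega> = g i) \<and> (\<forall>i\<in>{1..n}. ereal (s i) < xi i \<omega>)}
        = (if g 0 = f0 then 1 else 0) *
          (\<Prod>i\<in>{1..n}. p (g (i - 1)) (g i) * exp (- q (g (i - 1)) * s i))"
begin

section \<open>Law of the states and holding times from a given stage on\<close>

abbreviation "\<tau> \<equiv> jump_time xi"

lemma \<tau>_measurable [measurable]: "\<tau> n \<in> borel_measurable M"
  unfolding jump_time_def[abs_def] by measurable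

lemma \<tau>_0 [simp]: "\<tau> 0 \<omega> = 0"
  by (simp add: jump_time_def)

lemma \<tau>_Suc: "\<tau> (Suc n) \<omega> = \<tau> n \<omega> + xi (Suc n) \<omega>"
  by (simp add: jump_time_def)

lemma pred_h_in [measurable]: "Measurable.pred M (\<lambda>\<omega>. h n \<omega> \<in> A)"
  by (rule measurable_compose[OF h_measurable]) simp

text \<open>Total probability over a finite layer. Membership in the layer is a premise because
  \<open>chain_law\<close> splits in this way while that membership is still being established by
  induction.\<close>

lemma measure_split_h:
  assumes "AE \<omega> in M. h j \<omega> \<in> S j" and [measurable]: "Measurable.pred M P"
  shows "measure M {\<omega> \<in> space M. P \<omega>} = (\<Sum>\<gamma>\<in>S j. measure M {\<omega> \<in> space M. h j \<omega> = \<gamma> \<and> P \<omega>})"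
proof -
  have "measure M {\<omega> \<in> space M. P \<omega>} = measure M (\<Union>\<gamma>\<in>S j. {\<omega> \<in> space M. h j \<omega> = \<gamma> \<and> P \<omega>})"
    using assms(1) by (intro measure_eq_AE) auto
  also have "\<dots> = (\<Sum>\<gamma>\<in>S j. measure M {\<omega> \<in> space M. h j \<omega> = \<gamma> \<and> P \<omega>})"
    by (intro finite_measure_finite_Union) (auto simp: disjoint_family_on_def)
  finally show ?thesis .
qed

text \<open>Markov property from stage \<open>j\<close> on: \<open>fdd\<close> fixes the whole past,
  which is summed out one state at a time. The two claims need each other. Summing over
  \<open>h j\<close> requires it to lie in \<open>S j\<close>, while the law at stage
  \<open>j\<close> with zero bounds yields membership in the next layer and positivity of the next
  holding time. Positivity in turn lets the bound on a past holding time be dropped.\<close>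

lemma chain_law:
  "(AE \<omega> in M. h j \<omega> \<in> S j \<and> (\<forall>i\<in>{1..j}. 0 < xi i \<omega>)) \<and>
   (\<forall>n g s. j \<le> n \<longrightarrow> (\<forall>i. 0 \<le> s i) \<longrightarrow>
      measure M {\<omega> \<in> space M. (\<forall>i\<in>{j..n}. h i \<omega> = g i) \<and> (\<forall>i\<in>{Suc j..n}. ereal (s i) < xi i \<omega>)}
        = measure M {\<omega> \<in> space M. h j \<omega> = g j} *
          (\<Prod>i\<in>{Suc j..n}. p (g (i - 1)) (g i) * exp (- q (g (i - 1)) * s i)))"
proof (induction j)
  case 0
  have 1: "measure M {\<omega> \<in> space M. h 0 \<omega> = g} = (if g = f0 then 1 else 0)" for g
    using fdd[of "\<lambda>_. 0" 0 "\<lambda>_. g"] by simp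
  have "AE \<omega> in M. h 0 \<omega> = f0"
    using 1[of f0] by (simp add: prob_Collect_eq_1)
  moreover have "measure M {\<omega> \<in> space M. (\<forall>i\<in>{0..n}. h i \<omega> = g i) \<and> (\<forall>i\<in>{Suc 0..n}. ereal (s i) < xi i \<omega>)}
        = measure M {\<omega> \<in> space M. h 0 \<omega> = g 0} *
          (\<Prod>i\<in>{Suc 0..n}. p (g (i - 1)) (g i) * exp (- q (g (i - 1)) * s i))"
    if "\<forall>i. 0 \<le> s i" for n g s
    using fdd[of s n g] that unfolding 1 by (simp add: Ball_def atLeast0AtMost)
  ultimately show ?case by (simp add: S_0)
next
  case (Suc j)
  have AEh: "AE \<omega> in M. h j \<omega> \<in> S j" using Suc by auto
  have law: "measure M {\<omega> \<in> space M. (\<forall>i\<in>{j..n}. h i \<omega> = g i) \<and> (\<forall>i\<in>{Suc j..n}. ereal (s i) < xi i \<omega>)}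
        = measure M {\<omega> \<in> space M. h j \<omega> = g j} *
          (\<Prod>i\<in>{Suc j..n}. p (g (i - 1)) (g i) * exp (- q (g (i - 1)) * s i))"
    if "j \<le> n" "\<And>i. 0 \<le> s i" for n g s
    using Suc that by blast
  have two: "measure M {\<omega> \<in> space M. h j \<omega> = \<gamma> \<and> h (Suc j) \<omega> = \<gamma>' \<and> 0 < xi (Suc j) \<omega>} =
     measure M {\<omega> \<in> space M. h j \<omega> = \<gamma>} * p \<gamma> \<gamma>'" for \<gamma> \<gamma>'
  proof -
    have "{\<omega> \<in> space M. h j \<omega> = \<gamma> \<and> h (Suc j) \<omega> = \<gamma>' \<and> 0 < xi (Suc j) \<omega>} =
      {\<omega> \<in> space M. (\<forall>i\<in>{j..Suc j}. h i \<omega> = (if i = j then \<gamma> else \<gamma>')) \<and>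
         (\<forall>i\<in>{Suc j..Suc j}. ereal 0 < xi i \<omega>)}"
      by (auto simp: zero_ereal_def atLeastAtMostSuc_conv)
    then show ?thesis
      using law[of "Suc j" "\<lambda>_. 0" "\<lambda>i. if i = j then \<gamma> else \<gamma>'"] by simp
  qed
  \<comment> \<open>Summing \<open>two\<close> over both layers gives total mass one, because
    \<open>p_sum\<close> removes the inner sum; this proves membership and positivity at
    once.\<close>
  have "AE \<omega> in M. h (Suc j) \<omega> \<in> S (Suc j) \<and> 0 < xi (Suc j) \<omega>"
  proof -
    have "prob {\<omega> \<in> space M. h (Suc j) \<omega> \<in> S (Suc j) \<and> 0 < xi (Suc j) \<omega>} =
      (\<Sum>\<gamma>\<in>S j. prob {\<omega> \<in> space M. h j \<omega> = \<gamma> \<and> h (Suc j) \<omega> \<in> S (Suc j) \<and> 0 < xi (Suc j) \<omega>})"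
      by (intro measure_split_h AEh) measurable
    also have "\<dots> = (\<Sum>\<gamma>\<in>S j. \<Sum>\<gamma>'\<in>S (Suc j). prob {\<omega> \<in> space M. h j \<omega> = \<gamma> \<and> h (Suc j) \<omega> = \<gamma>' \<and> 0 < xi (Suc j) \<omega>})"
    proof (intro sum.cong refl)
      fix \<gamma>
      have "{\<omega> \<in> space M. h j \<omega> = \<gamma> \<and> h (Suc j) \<omega> \<in> S (Suc j) \<and> 0 < xi (Suc j) \<omega>} =
        (\<Union>\<gamma>'\<in>S (Suc j). {\<omega> \<in> space M. h j \<omega> = \<gamma> \<and> h (Suc j) \<omega> = \<gamma>' \<and> 0 < xi (Suc j) \<omega>})" by auto
      also have "prob \<dots> = (\<Sum>\<gamma>'\<in>S (Suc j). prob {\<omega> \<in> space M. h j \<omega> = \<gamma> \<and> h (Suc j) \<omega> = \<gamma>' \<and> 0 < xi (Suc j) \<omega>})"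
        by (intro finite_measure_finite_Union) (auto simp: disjoint_family_on_def)
      finally show "prob {\<omega> \<in> space M. h j \<omega> = \<gamma> \<and> h (Suc j) \<omega> \<in> S (Suc j) \<and> 0 < xi (Suc j) \<omega>} = \<dots>" .
    qed
    also have "\<dots> = (\<Sum>\<gamma>\<in>S j. prob {\<omega> \<in> space M. h j \<omega> = \<gamma>})"
      unfolding two by (intro sum.cong refl) (simp add: p_sum flip: sum_distrib_left)
    also have "\<dots> = prob {\<omega> \<in> space M. True}"
      using measure_split_h[OF AEh, of "\<lambda>_. True"] by simp
    also have "\<dots> = 1" by (simp add: prob_space)
    finally show ?thesis by (simp add: prob_Collect_eq_1)
  qed
  then have AE: "AE \<omega> in M. h (Suc j) \<omega> \<in> S (Suc j) \<and> (\<forall>i\<in>{1..Suc j}. 0 < xi i \<omega>)"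
    using conjunct1[OF Suc] by eventually_elim (auto simp: atLeastAtMostSuc_conv)
  have split: "measure M {\<omega> \<in> space M. (\<forall>i\<in>{Suc j..n}. h i \<omega> = g i) \<and> (\<forall>i\<in>{Suc (Suc j)..n}. ereal (s i) < xi i \<omega>)}
      = (\<Sum>\<gamma>\<in>S j. measure M {\<omega> \<in> space M. h j \<omega> = \<gamma>} * p \<gamma> (g (Suc j))) *
        (\<Prod>i\<in>{Suc (Suc j)..n}. p (g (i - 1)) (g i) * exp (- q (g (i - 1)) * s i))"
    (is "measure M {\<omega> \<in> space M. ?P \<omega>} = _ * ?\<Pi>")
    if n: "Suc j \<le> n" and s: "\<And>i. 0 \<le> s i" for n g s
  proof -
    have "measure M {\<omega> \<in> space M. ?P \<omega>} = (\<Sum>\<gamma>\<in>S j. measure M {\<omega> \<in> space M. h j \<omega> = \<gamma> \<and> ?P \<omega>})"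
      by (intro measure_split_h AEh) measurable
    also have "\<dots> = (\<Sum>\<gamma>\<in>S j. measure M {\<omega> \<in> space M. h j \<omega> = \<gamma>} * p \<gamma> (g (Suc j)) * ?\<Pi>)"
    proof (intro sum.cong refl)
      fix \<gamma>
      \<comment> \<open>The past state \<open>\<gamma>\<close> is put back at index
        \<open>j\<close>, with bound \<open>0\<close> on the holding time that leaves it, a
        condition that holds almost everywhere.\<close>
      define g' where "g' = g(j := \<gamma>)"
      define s' where "s' = s(Suc j := 0)"
      have "{j..n} = insert j {Suc j..n}" and I: "{Suc j..n} = insert (Suc j) {Suc (Suc j)..n}" using n by auto
      then have "measure M {\<omega> \<in> space M. h j \<omega> = \<gamma> \<and> ?P \<omega>} =
        measure M {\<omega> \<in> space M. (\<forall>i\<in>{j..n}. h i \<omega> = g' i) \<and> (\<forall>i\<in>{Suc j..n}. ereal (s' i) < xi i \<omega>)}"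
        using AE by (intro measure_eq_AE) (auto simp: g'_def s'_def zero_ereal_def)
      also have "\<dots> = measure M {\<omega> \<in> space M. h j \<omega> = \<gamma>} * (\<Prod>i\<in>{Suc j..n}. p (g' (i - 1)) (g' i) * exp (- q (g' (i - 1)) * s' i))"
        using n s by (subst law) (auto simp: g'_def s'_def)
      also have "(\<Prod>i\<in>{Suc j..n}. p (g' (i - 1)) (g' i) * exp (- q (g' (i - 1)) * s' i)) =
        p \<gamma> (g (Suc j)) * (\<Prod>i\<in>{Suc (Suc j)..n}. p (g' (i - 1)) (g' i) * exp (- q (g' (i - 1)) * s' i))"
        unfolding I by (subst prod.insert) (auto simp: g'_def s'_def)
      also have "(\<Prod>i\<in>{Suc (Suc j)..n}. p (g' (i - 1)) (g' i) * exp (- q (g' (i - 1)) * s' i)) = ?\<Pi>"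
        by (intro prod.cong) (auto simp: g'_def s'_def)
      finally show "measure M {\<omega> \<in> space M. h j \<omega> = \<gamma> \<and> ?P \<omega>} = measure M {\<omega> \<in> space M. h j \<omega> = \<gamma>} * p \<gamma> (g (Suc j)) * ?\<Pi>"
        by simp
    qed
    finally show ?thesis by (simp add: sum_distrib_right)
  qed
  have "measure M {\<omega> \<in> space M. h (Suc j) \<omega> = \<gamma>'} = (\<Sum>\<gamma>\<in>S j. measure M {\<omega> \<in> space M. h j \<omega> = \<gamma>} * p \<gamma> \<gamma>')" for \<gamma>'
    using split[of "Suc j" "\<lambda>_. 0" "\<lambda>_. \<gamma>'"] by simp
  with AE split show ?case by simp
qed

lemma AE_h_in_S: "AE \<omega> in M. h n \<omega> \<in> S n"
  using conjunct1[OF chain_law[of n]] by eventually_elim auto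

lemma AE_xi_pos: "AE \<omega> in M. \<forall>n\<ge>1. 0 < xi n \<omega>"
  unfolding AE_all_countable
proof
  fix n
  show "AE \<omega> in M. 1 \<le> n \<longrightarrow> 0 < xi n \<omega>"
    using conjunct1[OF chain_law[of n]] by eventually_elim auto
qed

lemma \<tau>_mono:
  assumes "\<forall>n\<ge>1. 0 < xi n \<omega>" "i \<le> j"
  shows "\<tau> i \<omega> \<le> \<tau> j \<omega>"
  unfolding jump_time_def using assms by (intro sum_mono2) (auto intro: less_imp_le)

lemma AE_\<tau>_nonneg: "AE \<omega> in M. 0 \<le> \<tau> n \<omega>"
  using AE_xi_pos by eventually_elim (use \<tau>_mono[of _ 0] in auto)

text \<open>\<open>\<alpha> n g t\<close> is the probability of \<open>h n = g\<close> and \<open>\<tau> n \<le> t\<close>, and \<open>\<beta> n g t\<close> that of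
  \<open>h n = g\<close> and \<open>\<tau> (n + 1) \<le> t\<close>.\<close>

primrec \<alpha> :: "nat \<Rightarrow> 's \<Rightarrow> real \<Rightarrow> real" where
  "\<alpha> 0 g t = (if g = f0 then 1 else 0)"
| "\<alpha> (Suc n) g t = (\<Sum>\<gamma>\<in>S n. exp_conv (q \<gamma>) (\<alpha> n \<gamma>) t * p \<gamma> g)"

definition \<beta> :: "nat \<Rightarrow> 's \<Rightarrow> real \<Rightarrow> real" where
  "\<beta> n g = exp_conv (q g) (\<alpha> n g)"

lemma \<alpha>_Suc: "\<alpha> (Suc n) g t = (\<Sum>\<gamma>\<in>S n. \<beta> n \<gamma> t * p \<gamma> g)"
  by (simp add: \<beta>_def)

declare \<alpha>.simps(2) [simp del]

lemma \<alpha>_continuous: "continuous_on {0..} (\<alpha> n g)"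
proof (induction n arbitrary: g)
  case (Suc n)
  then show ?case
    unfolding \<alpha>.simps(2)[abs_def] by (intro continuous_intros exp_conv_continuous)
qed auto

text \<open>The first \<open>j\<close> holding times enter only through their sum, the later ones
  keep separate bounds. The induction moves one holding time from the list into the sum by
  convolution; its tail comes from the law at the previous stage, which is why \<open>n\<close> and
  \<open>s\<close> stay general.\<close>

lemma \<tau>_law:
  assumes "0 \<le> t" "j \<le> n" "\<And>i. 0 \<le> s i"
  shows "measure M {\<omega> \<in> space M. (\<forall>i\<in>{j..n}. h i \<omega> = g i) \<and> \<tau> j \<omega> \<le> ereal t \<and> (\<forall>i\<in>{Suc j..n}. ereal (s i) < xi i \<omega>)}
        = \<alpha> j (g j) t * (\<Prod>i\<in>{Suc j..n}. p (g (i - 1)) (g i) * exp (- q (g (i - 1)) * s i))"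
  using assms
proof (induction j arbitrary: t n g s)
  case 0
  then show ?case using fdd[of s n g] by (simp add: Ball_def atLeast0AtMost)
next
  case (Suc j)
  let ?\<Pi> = "\<Prod>i\<in>{Suc (Suc j)..n}. p (g (i - 1)) (g i) * exp (- q (g (i - 1)) * s i)"
  define Q where "Q \<omega> \<longleftrightarrow> (\<forall>i\<in>{Suc j..n}. h i \<omega> = g i) \<and> (\<forall>i\<in>{Suc (Suc j)..n}. ereal (s i) < xi i \<omega>)" for \<omega>
  have [measurable]: "Measurable.pred M Q" unfolding Q_def by measurable
  have "measure M {\<omega> \<in> space M. (\<forall>i\<in>{Suc j..n}. h i \<omega> = g i) \<and> \<tau> (Suc j) \<omega> \<le> ereal t \<and> (\<forall>i\<in>{Suc (Suc j)..n}. ereal (s i) < xi i \<omega>)} =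
    measure M {\<omega> \<in> space M. Q \<omega> \<and> \<tau> (Suc j) \<omega> \<le> ereal t}"
    by (intro arg_cong[where f="measure M"]) (auto simp: Q_def)
  also have "\<dots> = (\<Sum>\<gamma>\<in>S j. measure M {\<omega> \<in> space M. h j \<omega> = \<gamma> \<and> Q \<omega> \<and> \<tau> (Suc j) \<omega> \<le> ereal t})"
    by (intro measure_split_h AE_h_in_S) measurable
  also have "\<dots> = (\<Sum>\<gamma>\<in>S j. \<beta> j \<gamma> t * p \<gamma> (g (Suc j)) * ?\<Pi>)"
  proof (intro sum.cong refl)
    fix \<gamma>
    define A where "A = {\<omega> \<in> space M. h j \<omega> = \<gamma> \<and> Q \<omega>}"
    have "{\<omega> \<in> space M. h j \<omega> = \<gamma> \<and> Q \<omega> \<and> \<tau> (Suc j) \<omega> \<le> ereal t} = {\<omega> \<in> A. \<tau> j \<omega> + xi (Suc j) \<omega> \<le> ereal t}"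
      by (auto simp: A_def \<tau>_Suc)
    \<comment> \<open>The transition probability into \<open>g (Suc j)\<close> and the remaining
      product do not depend on time, so they are absorbed into the function that is
      convolved.\<close>
    also have "measure M \<dots> = exp_conv (q \<gamma>) (\<lambda>u. \<alpha> j \<gamma> u * (p \<gamma> (g (Suc j)) * ?\<Pi>)) t"
    proof (rule measure_sum_exp_conv)
      show "A \<in> sets M" unfolding A_def by measurable
      show "AE \<omega> in M. 0 < xi (Suc j) \<omega>" using AE_xi_pos by eventually_elim auto
      show "continuous_on {0..} (\<lambda>u. \<alpha> j \<gamma> u * (p \<gamma> (g (Suc j)) * ?\<Pi>))"
        by (intro continuous_intros \<alpha>_continuous)
      fix t r :: real assume tr: "0 \<le> t" "0 \<le> r"
      define g' where "g' = g(j := \<gamma>)"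
      define s' where "s' = s(Suc j := r)"
      have "{j..n} = insert j {Suc j..n}" and I: "{Suc j..n} = insert (Suc j) {Suc (Suc j)..n}" using Suc.prems by auto
      then have "{\<omega> \<in> A. \<tau> j \<omega> \<le> ereal t \<and> ereal r < xi (Suc j) \<omega>} =
        {\<omega> \<in> space M. (\<forall>i\<in>{j..n}. h i \<omega> = g' i) \<and> \<tau> j \<omega> \<le> ereal t \<and> (\<forall>i\<in>{Suc j..n}. ereal (s' i) < xi i \<omega>)}"
        by (auto simp: A_def Q_def g'_def s'_def)
      also have "measure M \<dots> = \<alpha> j \<gamma> t * (\<Prod>i\<in>{Suc j..n}. p (g' (i - 1)) (g' i) * exp (- q (g' (i - 1)) * s' i))"
        using Suc.prems tr by (subst Suc.IH) (auto simp: g'_def s'_def)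
      also have "(\<Prod>i\<in>{Suc j..n}. p (g' (i - 1)) (g' i) * exp (- q (g' (i - 1)) * s' i)) =
        p \<gamma> (g (Suc j)) * exp (- q \<gamma> * r) * (\<Prod>i\<in>{Suc (Suc j)..n}. p (g' (i - 1)) (g' i) * exp (- q (g' (i - 1)) * s' i))"
        unfolding I by (subst prod.insert) (auto simp: g'_def s'_def)
      also have "(\<Prod>i\<in>{Suc (Suc j)..n}. p (g' (i - 1)) (g' i) * exp (- q (g' (i - 1)) * s' i)) = ?\<Pi>"
        by (intro prod.cong) (auto simp: g'_def s'_def)
      finally show "measure M {\<omega> \<in> A. \<tau> j \<omega> \<le> ereal t \<and> ereal r < xi (Suc j) \<omega>}
         = \<alpha> j \<gamma> t * (p \<gamma> (g (Suc j)) * ?\<Pi>) * exp (- q \<gamma> * r)"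
        by simp
    qed (use AE_\<tau>_nonneg q_nonneg Suc.prems in auto)
    finally show "measure M {\<omega> \<in> space M. h j \<omega> = \<gamma> \<and> Q \<omega> \<and> \<tau> (Suc j) \<omega> \<le> ereal t} = \<beta> j \<gamma> t * p \<gamma> (g (Suc j)) * ?\<Pi>"
      by (simp add: exp_conv_cmult \<beta>_def)
  qed
  finally show ?case by (simp add: \<alpha>_Suc sum_distrib_right)
qed

lemma \<alpha>_eq: "0 \<le> t \<Longrightarrow> \<alpha> n g t = measure M {\<omega> \<in> space M. h n \<omega> = g \<and> \<tau> n \<omega> \<le> ereal t}"
  using \<tau>_law[of t n n "\<lambda>_. 0" "\<lambda>_. g"] by simp

text \<open>\<open>\<tau>_law\<close> at \<open>Suc n\<close> would speak of the state after the
  jump. Keeping \<open>h n\<close> instead needs the tail of the next holding time given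
  \<open>h n\<close> alone, obtained by summing over the next state with
  \<open>p_sum\<close>.\<close>

lemma \<beta>_eq:
  assumes "0 \<le> t" "g \<in> S n"
  shows "\<beta> n g t = measure M {\<omega> \<in> space M. h n \<omega> = g \<and> \<tau> (Suc n) \<omega> \<le> ereal t}"
proof -
  define A where "A = {\<omega> \<in> space M. h n \<omega> = g}"
  have "{\<omega> \<in> space M. h n \<omega> = g \<and> \<tau> (Suc n) \<omega> \<le> ereal t} = {\<omega> \<in> A. \<tau> n \<omega> + xi (Suc n) \<omega> \<le> ereal t}"
    by (auto simp: A_def \<tau>_Suc)
  also have "measure M \<dots> = exp_conv (q g) (\<alpha> n g) t"
  proof (rule measure_sum_exp_conv)
    show "A \<in> sets M" unfolding A_def by measurable
    show "AE \<omega> in M. 0 < xi (Suc n) \<omega>" using AE_xi_pos by eventually_elim auto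
    fix t r :: real assume tr: "0 \<le> t" "0 \<le> r"
    have "measure M {\<omega> \<in> A. \<tau> n \<omega> \<le> ereal t \<and> ereal r < xi (Suc n) \<omega>} =
       measure M {\<omega> \<in> space M. h n \<omega> = g \<and> \<tau> n \<omega> \<le> ereal t \<and> ereal r < xi (Suc n) \<omega>}"
      by (intro arg_cong[where f="measure M"]) (auto simp: A_def)
    also have "\<dots> = (\<Sum>\<gamma>\<in>S (Suc n). measure M {\<omega> \<in> space M. h (Suc n) \<omega> = \<gamma> \<and> h n \<omega> = g \<and> \<tau> n \<omega> \<le> ereal t \<and> ereal r < xi (Suc n) \<omega>})"
      by (intro measure_split_h AE_h_in_S) measurable
    also have "\<dots> = (\<Sum>\<gamma>\<in>S (Suc n). \<alpha> n g t * exp (- q g * r) * p g \<gamma>)"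
    proof (intro sum.cong refl)
      fix \<gamma>
      have "{\<omega> \<in> space M. h (Suc n) \<omega> = \<gamma> \<and> h n \<omega> = g \<and> \<tau> n \<omega> \<le> ereal t \<and> ereal r < xi (Suc n) \<omega>} =
        {\<omega> \<in> space M. (\<forall>i\<in>{n..Suc n}. h i \<omega> = (if i = n then g else \<gamma>)) \<and> \<tau> n \<omega> \<le> ereal t \<and>
         (\<forall>i\<in>{Suc n..Suc n}. ereal r < xi i \<omega>)}"
        by (auto simp: atLeastAtMostSuc_conv)
      then show "measure M {\<omega> \<in> space M. h (Suc n) \<omega> = \<gamma> \<and> h n \<omega> = g \<and> \<tau> n \<omega> \<le> ereal t \<and> ereal r < xi (Suc n) \<omega>}
        = \<alpha> n g t * exp (- q g * r) * p g \<gamma>"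
        using tr \<tau>_law[of t n "Suc n" "\<lambda>_. r" "\<lambda>i. if i = n then g else \<gamma>"] by simp
    qed
    also have "\<dots> = \<alpha> n g t * exp (- q g * r)"
      using p_sum[OF assms(2)] by (simp flip: sum_distrib_left)
    finally show "measure M {\<omega> \<in> A. \<tau> n \<omega> \<le> ereal t \<and> ereal r < xi (Suc n) \<omega>} = \<alpha> n g t * exp (- q g * r)" .
  qed (use AE_\<tau>_nonneg q_nonneg \<alpha>_continuous assms in auto)
  finally show ?thesis by (simp add: \<beta>_def)
qed

text \<open>Built from the recursion rather than as a measure, so that continuity and derivatives
  come from \<open>exp_conv\<close>; \<open>occ_eq\<close> identifies it with the probability of
  being in \<open>g\<close> at time \<open>t\<close> after exactly \<open>n\<close> jumps.\<close>

definition occ :: "nat \<Rightarrow> 's \<Rightarrow> real \<Rightarrow> real" where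
  "occ n g t = \<alpha> n g t - \<beta> n g t"

lemma occ_eq:
  assumes "0 \<le> t" "g \<in> S n"
  shows "occ n g t = measure M {\<omega> \<in> space M. h n \<omega> = g \<and> \<tau> n \<omega> \<le> ereal t \<and> ereal t < \<tau> (Suc n) \<omega>}"
proof -
  have "measure M {\<omega> \<in> space M. h n \<omega> = g \<and> \<tau> (Suc n) \<omega> \<le> ereal t} =
    measure M {\<omega> \<in> space M. h n \<omega> = g \<and> \<tau> n \<omega> \<le> ereal t \<and> \<tau> (Suc n) \<omega> \<le> ereal t}"
  proof (intro measure_eq_AE)
    show "AE x in M. (x \<in> {\<omega> \<in> space M. h n \<omega> = g \<and> \<tau> (Suc n) \<omega> \<le> ereal t}) =
      (x \<in> {\<omega> \<in> space M. h n \<omega> = g \<and> \<tau> n \<omega> \<le> ereal t \<and> \<tau> (Suc n) \<omega> \<le> ereal t})"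
      using AE_xi_pos
    proof eventually_elim
      case (elim \<omega>)
      then show ?case using \<tau>_mono[OF elim, of n "Suc n"] by (auto intro: order_trans)
    qed
  qed measurable
  then have "occ n g t = measure M {\<omega> \<in> space M. h n \<omega> = g \<and> \<tau> n \<omega> \<le> ereal t} -
     measure M {\<omega> \<in> space M. h n \<omega> = g \<and> \<tau> n \<omega> \<le> ereal t \<and> \<tau> (Suc n) \<omega> \<le> ereal t}"
    using assms by (simp add: occ_def \<alpha>_eq \<beta>_eq)
  also have "\<dots> = measure M ({\<omega> \<in> space M. h n \<omega> = g \<and> \<tau> n \<omega> \<le> ereal t} -
     {\<omega> \<in> space M. h n \<omega> = g \<and> \<tau> n \<omega> \<le> ereal t \<and> \<tau> (Suc n) \<omega> \<le> ereal t})"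
    by (intro finite_measure_Diff[symmetric]) auto
  also have "\<dots> = measure M {\<omega> \<in> space M. h n \<omega> = g \<and> \<tau> n \<omega> \<le> ereal t \<and> ereal t < \<tau> (Suc n) \<omega>}"
    by (intro arg_cong[where f="measure M"]) auto
  finally show ?thesis .
qed

lemma occ_nonneg: "0 \<le> t \<Longrightarrow> g \<in> S n \<Longrightarrow> 0 \<le> occ n g t"
  by (simp add: occ_eq)

lemma \<alpha>_nonneg: "0 \<le> t \<Longrightarrow> 0 \<le> \<alpha> n g t"
  by (simp add: \<alpha>_eq)

lemma \<beta>_has_derivative:
  "0 \<le> t \<Longrightarrow> (\<beta> n g has_real_derivative q g * occ n g t) (at t within {0..})"
  unfolding \<beta>_def occ_def by (rule exp_conv_has_derivative[OF \<alpha>_continuous])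

text \<open>\<open>EP n G t\<close>, \<open>EA n G t\<close> and \<open>EB n G t\<close> are the expectations of \<open>G (h n)\<close> on the events
  \<open>\<tau> n \<le> t < \<tau> (n + 1)\<close>, \<open>\<tau> n \<le> t\<close> and \<open>\<tau> (n + 1) \<le> t\<close>.\<close>

definition EP :: "nat \<Rightarrow> ('s \<Rightarrow> real) \<Rightarrow> real \<Rightarrow> real" where
  "EP n G t = (\<Sum>g\<in>S n. G g * occ n g t)"

text \<open>The conditional expectation of \<open>G (h (n + 1))\<close> given
  \<open>h n = g\<close>; the generator applied to \<open>G\<close> is
  \<open>q g * (avg n G g - G g)\<close>.\<close>

definition avg :: "nat \<Rightarrow> ('s \<Rightarrow> real) \<Rightarrow> 's \<Rightarrow> real" where
  "avg n G g = (\<Sum>g'\<in>S (Suc n). p g g' * G g')"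

definition EA :: "nat \<Rightarrow> ('s \<Rightarrow> real) \<Rightarrow> real \<Rightarrow> real" where
  "EA n G t = (\<Sum>g\<in>S n. G g * \<alpha> n g t)"

definition EB :: "nat \<Rightarrow> ('s \<Rightarrow> real) \<Rightarrow> real \<Rightarrow> real" where
  "EB n G t = (\<Sum>g\<in>S n. G g * \<beta> n g t)"

lemma EP_eq: "EP n G t = EA n G t - EB n G t"
  by (simp add: EP_def EA_def EB_def occ_def right_diff_distrib sum_subtractf)

lemma EA_0: "EA 0 G t = G f0"
  by (simp add: EA_def S_0)

text \<open>Conditioning on the state before jump \<open>n + 1\<close>, on the common event
  \<open>\<tau> (n + 1) \<le> t\<close>. This reduces every time derivative to that of
  \<open>EB\<close>.\<close>

lemma EA_Suc: "EA (Suc n) G t = EB n (avg n G) t"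
proof -
  have "EA (Suc n) G t = (\<Sum>g'\<in>S (Suc n). \<Sum>g\<in>S n. p g g' * G g' * \<beta> n g t)"
    by (simp add: EA_def \<alpha>_Suc sum_distrib_left mult_ac)
  also have "\<dots> = EB n (avg n G) t"
    by (subst sum.swap) (simp add: EB_def avg_def sum_distrib_right)
  finally show ?thesis .
qed

lemma EB_0: "EB n G 0 = 0"
  by (simp add: EB_def \<beta>_def)

lemma EB_has_derivative:
  assumes "0 \<le> t"
  shows "(EB n G has_real_derivative EP n (\<lambda>g. q g * G g) t) (at t within {0..})"
proof -
  have "EP n (\<lambda>g. q g * G g) t = (\<Sum>g\<in>S n. G g * (q g * occ n g t))"
    by (simp add: EP_def mult_ac)
  then show ?thesis
    unfolding EB_def[abs_def]
    using \<beta>_has_derivative[OF assms] by (auto intro!: DERIV_sum DERIV_cmult)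
qed

lemma EP_continuous: "continuous_on {0..} (EP n G)"
proof -
  have "continuous_on {0..} (\<beta> n g)" for g
    unfolding \<beta>_def by (rule exp_conv_continuous[OF \<alpha>_continuous])
  then show ?thesis
    unfolding EP_def[abs_def] occ_def by (intro continuous_intros \<alpha>_continuous)
qed

text \<open>Summation by parts: shifting the index of \<open>EA\<close> pairs terms on the same
  event \<open>\<tau> (n + 1) \<le> t\<close>, and the difference of such a pair changes at the rate
  given by the generator. The price is the boundary term \<open>EA N G t\<close>.\<close>

lemma sum_EP_eq: "(\<Sum>n<N. EP n G t) = G f0 - EA N G t + (\<Sum>n<N. EA (Suc n) G t - EB n G t)"
  by (induction N) (auto simp: EA_0 EP_eq)

lemma EP_mono:
  assumes "0 \<le> t" "\<And>g. g \<in> S n \<Longrightarrow> G g \<le> G' g"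
  shows "EP n G t \<le> EP n G' t"
  unfolding EP_def using assms by (intro sum_mono mult_right_mono occ_nonneg)

lemma EP_nonneg:
  assumes "0 \<le> t" "\<And>g. g \<in> S n \<Longrightarrow> 0 \<le> G g"
  shows "0 \<le> EP n G t"
  unfolding EP_def using assms by (intro sum_nonneg mult_nonneg_nonneg occ_nonneg)

lemma EP_cmult: "EP n (\<lambda>g. c * G g) t = c * EP n G t"
  by (simp add: EP_def sum_distrib_left mult_ac)

lemma EP_cong: "(\<And>g. g \<in> S n \<Longrightarrow> G g = G' g) \<Longrightarrow> EP n G t = EP n G' t"
  by (simp add: EP_def)

lemma EP_diff: "EP n (\<lambda>g. G g - G' g) t = EP n G t - EP n G' t"
  by (simp add: EP_def left_diff_distrib sum_subtractf)

lemma EP_sum: "EP n (\<lambda>g. \<Sum>i\<in>A. G i g) t = (\<Sum>i\<in>A. EP n (G i) t)"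
  unfolding EP_def sum_distrib_right by (rule sum.swap)

lemma abs_EP_le:
  assumes "0 \<le> t"
  shows "\<bar>EP n G t\<bar> \<le> EP n (\<lambda>g. \<bar>G g\<bar>) t"
  unfolding EP_def
  by (rule order_trans[OF sum_abs]) (use assms occ_nonneg in \<open>auto simp: abs_mult intro!: sum_mono\<close>)

lemma increment_has_derivative:
  assumes "0 \<le> t"
  shows "((\<lambda>t. EA (Suc n) G t - EB n G t) has_real_derivative
    EP n (\<lambda>g. q g * (avg n G g - G g)) t) (at t within {0..})"
proof -
  have "EP n (\<lambda>g. q g * (avg n G g - G g)) t = EP n (\<lambda>g. q g * avg n G g) t - EP n (\<lambda>g. q g * G g) t"
    by (simp add: right_diff_distrib EP_diff)
  then show ?thesis
    unfolding EA_Suc[abs_def] by (auto intro!: derivative_intros EB_has_derivative assms)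
qed

end

section \<open>Dynkin's formula under a Lyapunov condition\<close>

text \<open>The step condition is restricted to \<open>p g g' \<noteq> 0\<close> because
  \<open>S (Suc n)\<close> also holds states reached only from other elements of \<open>S n\<close>.
  The lower bound on \<open>W\<close> lets lower powers be absorbed into higher ones.\<close>

locale lyapunov_chain = jump_chain +
  fixes W :: "'b \<Rightarrow> real" and K c :: real
  assumes W_ge_1: "\<And>n g. g \<in> S n \<Longrightarrow> 1 \<le> W g"
    and K_nonneg: "0 \<le> K" and c_nonneg: "0 \<le> c"
    and q_le: "\<And>n g. g \<in> S n \<Longrightarrow> q g \<le> K * W g"
    and W_step: "\<And>n g g'. g \<in> S n \<Longrightarrow> g' \<in> S (Suc n) \<Longrightarrow> p g g' \<noteq> 0 \<Longrightarrow> W g' \<le> W g + c"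
begin

text \<open>A jump raises \<open>W\<^sup>2\<close> by at most
  \<open>2 * c * W + c\<^sup>2 \<le> (2 * c + c\<^sup>2) * W\<close>, and the rate contributes
  another factor \<open>K * W\<close>.\<close>

definition growth :: real where
  "growth = K * (2 * c + c\<^sup>2)"

definition moment :: "real \<Rightarrow> real" where
  "moment t = (W f0)\<^sup>2 * exp (growth * t)"

lemma growth_nonneg: "0 \<le> growth"
  by (simp add: growth_def K_nonneg c_nonneg)

lemma drift_W2:
  assumes g: "g \<in> S n"
  shows "q g * (avg n (\<lambda>g. (W g)\<^sup>2) g - (W g)\<^sup>2) \<le> growth * (W g)\<^sup>2"
proof -
  have W: "1 \<le> W g" using W_ge_1[OF g] .
  have "avg n (\<lambda>g. (W g)\<^sup>2) g \<le> (\<Sum>g'\<in>S (Suc n). p g g' * (W g + c)\<^sup>2)"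
    unfolding avg_def
  proof (intro sum_mono)
    fix g' assume g': "g' \<in> S (Suc n)"
    show "p g g' * (W g')\<^sup>2 \<le> p g g' * (W g + c)\<^sup>2"
    proof (cases "p g g' = 0")
      case False
      then show ?thesis
        using W_step[OF g g'] W_ge_1[OF g'] p_nonneg by (intro mult_left_mono power_mono) auto
    qed auto
  qed
  also have "\<dots> = (W g + c)\<^sup>2" using p_sum[OF g] by (simp flip: sum_distrib_right)
  finally have 1: "avg n (\<lambda>g. (W g)\<^sup>2) g - (W g)\<^sup>2 \<le> 2 * c * W g + c\<^sup>2 * 1"
    by (simp add: power2_eq_square algebra_simps)
  also have "\<dots> \<le> 2 * c * W g + c\<^sup>2 * W g"
    using W by (intro add_left_mono mult_left_mono) auto
  finally have 1: "avg n (\<lambda>g. (W g)\<^sup>2) g - (W g)\<^sup>2 \<le> (2 * c + c\<^sup>2) * W g"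
    by (simp add: algebra_simps)
  have "q g * (avg n (\<lambda>g. (W g)\<^sup>2) g - (W g)\<^sup>2) \<le> q g * ((2 * c + c\<^sup>2) * W g)"
    by (intro mult_left_mono 1 q_nonneg)
  also have "\<dots> \<le> K * W g * ((2 * c + c\<^sup>2) * W g)"
    using q_le[OF g] c_nonneg W by (intro mult_right_mono) auto
  finally show ?thesis by (simp add: growth_def power2_eq_square mult_ac)
qed

text \<open>Gronwall for the partial sums, uniformly in \<open>N\<close>. Truncation subtracts
  \<open>EA N\<close>, which is nondecreasing in time, so the drift inequality survives with the
  right sign and the argument stays within finite sums.\<close>

lemma sum_EP_W2_le:
  assumes t: "0 \<le> t"
  shows "(\<Sum>n<N. EP n (\<lambda>g. (W g)\<^sup>2) t) \<le> moment t"
proof -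
  let ?G = "\<lambda>g. (W g)\<^sup>2"
  define s where "s t = (\<Sum>n<N. EP n ?G t)" for t
  define d where "d t = (case N of 0 \<Rightarrow> 0 | Suc k \<Rightarrow> EP k (\<lambda>g. q g * avg k ?G g) t)" for t
  have dA: "(EA N ?G has_real_derivative d t) (at t within {0..})" if "0 \<le> t" for t
  proof (cases N)
    case 0
    then show ?thesis by (simp add: d_def EA_0[abs_def])
  next
    case (Suc k)
    then show ?thesis unfolding d_def by (simp add: EA_Suc[abs_def] EB_has_derivative that)
  qed
  have d_nonneg: "0 \<le> d t" if "0 \<le> t" for t
    unfolding d_def avg_def
    by (auto split: nat.split intro!: EP_nonneg that mult_nonneg_nonneg q_nonneg sum_nonneg p_nonneg)
  let ?L = "\<lambda>t. \<Sum>n<N. EP n (\<lambda>g. q g * (avg n ?G g - ?G g)) t"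
  have ds: "(s has_real_derivative ?L t - d t) (at t within {0..})" if "0 \<le> t" for t
    unfolding s_def[abs_def] sum_EP_eq
    using DERIV_add[OF DERIV_diff[OF DERIV_const dA[OF that]] DERIV_sum[OF increment_has_derivative[OF that]]]
    by (simp add: algebra_simps)
  have L_le: "?L t \<le> growth * s t" if "0 \<le> t" for t
  proof -
    have "?L t \<le> (\<Sum>n<N. EP n (\<lambda>g. growth * ?G g) t)"
      by (intro sum_mono EP_mono that drift_W2)
    then show ?thesis by (simp add: EP_cmult s_def sum_distrib_left)
  qed
  \<comment> \<open>The integrating factor turns the differential inequality into
    monotonicity.\<close>
  let ?e = "\<lambda>t. exp (- growth * t) * s t"
  have de: "(?e has_real_derivative exp (- growth * t) * (?L t - d t - growth * s t)) (at t within {0..})"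
    if "0 \<le> t" for t
    by (rule derivative_eq_intros ds that refl | simp add: algebra_simps)+
  have "?e t \<le> ?e 0"
  proof (rule DERIV_nonpos_imp_decreasing_open[OF t])
    fix x assume x: "0 < x" "x < t"
    then have "at x within {0..} = at x" by (intro at_within_interior) auto
    with de[of x] x have "(?e has_real_derivative exp (- growth * x) * (?L x - d x - growth * s x)) (at x)" by simp
    moreover have "exp (- growth * x) * (?L x - d x - growth * s x) \<le> 0"
      using L_le[of x] d_nonneg[of x] x by (intro mult_nonneg_nonpos) auto
    ultimately show "\<exists>y. (?e has_real_derivative y) (at x) \<and> y \<le> 0" by blast
  next
    have "continuous_on {0..} s" unfolding s_def by (intro continuous_intros EP_continuous)
    then show "continuous_on {0..t} ?e"
      by (intro continuous_intros) (auto elim: continuous_on_subset)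
  qed
  also have "?e 0 \<le> (W f0)\<^sup>2"
  proof -
    have "0 \<le> EA N ?G 0" unfolding EA_def by (intro sum_nonneg mult_nonneg_nonneg \<alpha>_nonneg) auto
    then show ?thesis by (simp add: s_def sum_EP_eq EA_Suc EB_0)
  qed
  finally have "exp (growth * t) * ?e t \<le> exp (growth * t) * (W f0)\<^sup>2" by (intro mult_left_mono) auto
  then show ?thesis by (simp add: s_def moment_def mult_ac flip: mult.assoc exp_add)
qed

section \<open>Functionals of linear growth and limits over the number of jumps\<close>

lemma moment_nonneg: "0 \<le> moment t"
  by (simp add: moment_def)

lemma moment_mono: "s \<le> t \<Longrightarrow> moment s \<le> moment t"
  unfolding moment_def using growth_nonneg by (intro mult_left_mono) (auto intro: mult_left_mono)

text \<open>Linear growth is what a second moment can handle, since the rates cost one more factor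
  \<open>W\<close>. One constant serves all layers.\<close>

definition dominated :: "real \<Rightarrow> ('b \<Rightarrow> real) \<Rightarrow> bool" where
  "dominated C G \<longleftrightarrow> 0 \<le> C \<and> (\<forall>n. \<forall>g\<in>S n. \<bar>G g\<bar> \<le> C * W g)"

lemma W_le_W2: "g \<in> S n \<Longrightarrow> W g \<le> (W g)\<^sup>2"
  using W_ge_1[of g n] by (simp add: power2_eq_square)

text \<open>\<open>G\<close> may vary with \<open>n\<close> because \<open>EA_LIMSEQ\<close> uses
  this for \<open>q g * avg n G g\<close>, where the average depends on the layer.\<close>

lemma sum_abs_EP_le:
  assumes t: "0 \<le> t" and C: "0 \<le> C" and G: "\<And>n g. g \<in> S n \<Longrightarrow> \<bar>G n g\<bar> \<le> C * (W g)\<^sup>2"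
  shows "(\<Sum>n<N. \<bar>EP n (G n) t\<bar>) \<le> C * moment t"
proof -
  have "(\<Sum>n<N. \<bar>EP n (G n) t\<bar>) \<le> (\<Sum>n<N. EP n (\<lambda>g. C * (W g)\<^sup>2) t)"
    by (intro sum_mono order_trans[OF abs_EP_le[OF t]] EP_mono[OF t] G)
  also have "\<dots> = C * (\<Sum>n<N. EP n (\<lambda>g. (W g)\<^sup>2) t)"
    by (simp add: EP_cmult sum_distrib_left)
  also have "\<dots> \<le> C * moment t" by (intro mult_left_mono sum_EP_W2_le t C)
  finally show ?thesis .
qed

lemma summable_abs_EP:
  assumes t: "0 \<le> t" and C: "0 \<le> C" and G: "\<And>n g. g \<in> S n \<Longrightarrow> \<bar>G n g\<bar> \<le> C * (W g)\<^sup>2"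
  shows "summable (\<lambda>n. \<bar>EP n (G n) t\<bar>)"
  by (rule summableI_nonneg_bounded[where x="C * moment t"]) (auto intro!: sum_abs_EP_le assms)

lemma dominated_W2: "dominated C G \<Longrightarrow> g \<in> S n \<Longrightarrow> \<bar>G g\<bar> \<le> C * (W g)\<^sup>2"
  unfolding dominated_def by (meson W_le_W2 mult_left_mono order_trans)

text \<open>The expectation of \<open>G\<close> at the state of time \<open>t\<close>, split by the
  number of jumps up to \<open>t\<close>; \<open>integral_path_val\<close> confirms this.\<close>

definition expect :: "('b \<Rightarrow> real) \<Rightarrow> real \<Rightarrow> real" where
  "expect G t = (\<Sum>n. EP n G t)"

lemma
  assumes "dominated C G" "0 \<le> t"
  shows summable_EP: "summable (\<lambda>n. EP n G t)"
    and abs_sum_EP_le: "\<bar>\<Sum>n<N. EP n G t\<bar> \<le> C * moment t"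
proof -
  have C: "0 \<le> C" using assms by (simp add: dominated_def)
  have "summable (\<lambda>n. \<bar>EP n G t\<bar>)"
    using summable_abs_EP[of t C "\<lambda>_. G"] dominated_W2[OF assms(1)] assms(2) C by auto
  then show "summable (\<lambda>n. EP n G t)" by (rule summable_rabs_cancel)
  show "\<bar>\<Sum>n<N. EP n G t\<bar> \<le> C * moment t"
    by (rule order_trans[OF sum_abs sum_abs_EP_le[of t C "\<lambda>_. G"]]) (use dominated_W2[OF assms(1)] assms(2) C in auto)
qed

lemma expect_LIMSEQ:
  assumes "dominated C G" "0 \<le> t"
  shows "(\<lambda>N. \<Sum>n<N. EP n G t) \<longlonglongrightarrow> expect G t"
  unfolding expect_def using summable_EP[OF assms] by (rule summable_LIMSEQ)

lemma
  assumes "dominated C G" "0 \<le> t"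
  shows expect_integrable: "expect G integrable_on {0..t}"
    and integral_expect_LIMSEQ: "(\<lambda>N. integral {0..t} (\<lambda>s. \<Sum>n<N. EP n G s)) \<longlonglongrightarrow> integral {0..t} (expect G)"
proof -
  have 1: "(\<lambda>s. \<Sum>n<N. EP n G s) integrable_on {0..t}" for N
    by (intro integrable_continuous_interval continuous_intros continuous_on_subset[OF EP_continuous]) auto
  have 2: "norm (\<Sum>n<N. EP n G s) \<le> C * moment t" if "s \<in> {0..t}" for s N
  proof -
    have "norm (\<Sum>n<N. EP n G s) \<le> C * moment s" using abs_sum_EP_le[OF assms(1)] that by simp
    also have "\<dots> \<le> C * moment t"
      using assms(1) that by (intro mult_left_mono moment_mono) (auto simp: dominated_def)
    finally show ?thesis .
  qed
  note dc = dominated_convergence[where S="{0..t}" and f="\<lambda>N s. \<Sum>n<N. EP n G s" and h="\<lambda>_. C * moment t" and g="expect G"]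
  show "expect G integrable_on {0..t}"
    by (rule dc(1)) (use 1 2 expect_LIMSEQ[OF assms(1)] in auto)
  show "(\<lambda>N. integral {0..t} (\<lambda>s. \<Sum>n<N. EP n G s)) \<longlonglongrightarrow> integral {0..t} (expect G)"
    by (rule dc(2)) (use 1 2 expect_LIMSEQ[OF assms(1)] in auto)
qed

text \<open>\<open>EA (Suc n)\<close> is the time integral of the \<open>n\<close>-th term of a
  series whose absolute values sum to at most a multiple of \<open>moment t\<close>. The terms
  vanish pointwise, and dominated convergence passes this to the integral.\<close>

lemma EA_LIMSEQ:
  assumes G: "dominated C G" and t: "0 \<le> t"
  shows "(\<lambda>N. EA N G t) \<longlonglongrightarrow> 0"
proof -
  let ?H = "\<lambda>n g. q g * avg n G g"
  have C: "0 \<le> C" using G by (simp add: dominated_def)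
  \<comment> \<open>From \<open>q g \<le> K * W g\<close> and \<open>\<bar>avg n G g\<bar> \<le> C *
    (W g + c) \<le> C * (1 + c) * W g\<close>.\<close>
  define D where "D = K * (C * (1 + c))"
  have D: "0 \<le> D" by (simp add: D_def C K_nonneg c_nonneg)
  have H: "\<bar>?H n g\<bar> \<le> D * (W g)\<^sup>2" if g: "g \<in> S n" for n g
  proof -
    have W: "1 \<le> W g" using W_ge_1[OF g] .
    have "\<bar>avg n G g\<bar> \<le> (\<Sum>g'\<in>S (Suc n). p g g' * (C * (W g + c)))"
      unfolding avg_def
    proof (intro order_trans[OF sum_abs] sum_mono)
      fix g' assume g': "g' \<in> S (Suc n)"
      show "\<bar>p g g' * G g'\<bar> \<le> p g g' * (C * (W g + c))"
      proof (cases "p g g' = 0")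
        case False
        have "\<bar>G g'\<bar> \<le> C * W g'" using G g' by (auto simp: dominated_def)
        also have "\<dots> \<le> C * (W g + c)" using W_step[OF g g' False] C by (intro mult_left_mono)
        finally show ?thesis using p_nonneg[of g g'] by (simp add: abs_mult mult_left_mono)
      qed auto
    qed
    also have "\<dots> = C * (W g + c)" using p_sum[OF g] by (simp flip: sum_distrib_right)
    also have "\<dots> \<le> C * (W g + c * W g)" using W C c_nonneg by (intro mult_left_mono add_left_mono) (auto simp: mult_le_cancel_left1)
    finally have "\<bar>avg n G g\<bar> \<le> C * (1 + c) * W g" by (simp add: algebra_simps)
    then have "q g * \<bar>avg n G g\<bar> \<le> K * W g * (C * (1 + c) * W g)"
      using q_le[OF g] q_nonneg W K_nonneg by (intro mult_mono) auto
    then show ?thesis using q_nonneg[of g] by (simp add: abs_mult D_def power2_eq_square mult_ac)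
  qed
  have EA: "EA (Suc n) G t = integral {0..t} (EP n (?H n))" for n
  proof -
    have "(EP n (?H n) has_integral EB n (avg n G) t - EB n (avg n G) 0) {0..t}"
      by (intro has_integral_derivative_Ici EB_has_derivative t)
    then show ?thesis by (simp add: EB_0 EA_Suc integral_unique)
  qed
  have "(\<lambda>n. integral {0..t} (EP n (?H n))) \<longlonglongrightarrow> integral {0..t} (\<lambda>_. 0)"
  proof (rule dominated_convergence(2)[where h="\<lambda>_. D * moment t"])
    fix n
    show "EP n (?H n) integrable_on {0..t}"
      by (intro integrable_continuous_interval continuous_on_subset[OF EP_continuous]) auto
    fix s assume s: "s \<in> {0..t}"
    have "\<bar>EP n (?H n) s\<bar> \<le> (\<Sum>n<Suc n. \<bar>EP n (?H n) s\<bar>)" by simp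
    also have "\<dots> \<le> D * moment s" using s H D by (intro sum_abs_EP_le) auto
    also have "\<dots> \<le> D * moment t" using s D by (intro mult_left_mono moment_mono) auto
    finally show "norm (EP n (?H n) s) \<le> D * moment t" by simp
  next
    fix s assume s: "s \<in> {0..t}"
    have "summable (\<lambda>n. \<bar>EP n (?H n) s\<bar>)" using s H D by (intro summable_abs_EP) auto
    then show "(\<lambda>n. EP n (?H n) s) \<longlonglongrightarrow> 0"
      by (intro tendsto_rabs_zero_cancel[OF summable_LIMSEQ_zero])
  qed auto
  then have "(\<lambda>n. EA (Suc n) G t) \<longlonglongrightarrow> 0" by (simp add: EA)
  then show ?thesis by (rule LIMSEQ_imp_Suc)
qed

text \<open>\<open>sum_EP_eq\<close>, with the increments written as time integrals, in the limit of
  large \<open>N\<close>. \<open>LG\<close> is one function for all layers, although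
  \<open>avg n\<close> depends on \<open>n\<close>; its linear growth is a property of the
  particular \<open>G\<close>, as the general estimate only gives order
  \<open>W\<^sup>2\<close>.\<close>

theorem dynkin:
  assumes G: "dominated C G" and LG: "dominated C' LG" and t: "0 \<le> t"
    and L: "\<And>n g. g \<in> S n \<Longrightarrow> q g * (avg n G g - G g) = LG g"
  shows "expect G t = G f0 + integral {0..t} (expect LG)"
proof -
  have "(\<Sum>n<N. EP n G t) = G f0 - EA N G t + integral {0..t} (\<lambda>s. \<Sum>n<N. EP n LG s)" for N
  proof -
    have "((\<lambda>s. \<Sum>n<N. EP n LG s) has_integral
      (\<Sum>n<N. EA (Suc n) G t - EB n G t) - (\<Sum>n<N. EA (Suc n) G 0 - EB n G 0)) {0..t}"
    proof (rule has_integral_derivative_Ici[OF t])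
      fix s :: real assume s: "0 \<le> s"
      have "EP n LG s = EP n (\<lambda>g. q g * (avg n G g - G g)) s" for n
        by (intro EP_cong) (simp add: L)
      then show "((\<lambda>t. \<Sum>n<N. EA (Suc n) G t - EB n G t) has_real_derivative (\<Sum>n<N. EP n LG s)) (at s within {0..})"
        using increment_has_derivative[OF s] by (auto intro!: DERIV_sum)
    qed
    then show ?thesis by (simp add: sum_EP_eq EA_Suc EB_0 integral_unique)
  qed
  moreover have "(\<lambda>N. G f0 - EA N G t + integral {0..t} (\<lambda>s. \<Sum>n<N. EP n LG s)) \<longlonglongrightarrow> G f0 - 0 + integral {0..t} (expect LG)"
    by (intro tendsto_intros EA_LIMSEQ[OF G t] integral_expect_LIMSEQ[OF LG t])
  ultimately show ?thesis
    using LIMSEQ_unique[OF expect_LIMSEQ[OF G t]] by simp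
qed

text \<open>Demanding \<open>s < \<tau> j\<close> for all \<open>j > n\<close> makes the identity with the state at time \<open>s\<close> hold
  everywhere, also on the null set where \<open>\<tau>\<close> fails to be increasing. An identity that only holds almost
  everywhere would not give measurability of the state, as \<open>M\<close> need not be complete.\<close>

definition path_val :: "('b \<Rightarrow> real) \<Rightarrow> real \<Rightarrow> 'a \<Rightarrow> real" where
  "path_val G s \<omega> = (\<Sum>n. if \<tau> n \<omega> \<le> ereal s \<and> (\<forall>j>n. ereal s < \<tau> j \<omega>) then G (h n \<omega>) else 0)"

text \<open>Only the index of the last jump up to \<open>s\<close> passes the test in the series. If
  infinitely many jump times are at most \<open>s\<close>, no index passes and the value is zero,
  which matches the convention in \<open>ips_state\<close>.\<close>

lemma
  assumes s: "0 \<le> s"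
  shows path_val_eq: "path_val G s \<omega> =
      (if finite {n. \<tau> n \<omega> \<le> ereal s} then G (h (Max {n. \<tau> n \<omega> \<le> ereal s}) \<omega>) else 0)"
    and path_terms_summable:
      "summable (\<lambda>n. norm (if \<tau> n \<omega> \<le> ereal s \<and> (\<forall>j>n. ereal s < \<tau> j \<omega>) then G (h n \<omega>) else 0))"
proof -
  let ?N = "{n. \<tau> n \<omega> \<le> ereal s}"
  let ?f = "\<lambda>n. if \<tau> n \<omega> \<le> ereal s \<and> (\<forall>j>n. ereal s < \<tau> j \<omega>) then G (h n \<omega>) else 0"
  have "0 \<in> ?N" using s by simp
  then have "?N \<noteq> {}" by blast
  have "path_val G s \<omega> = (if finite ?N then G (h (Max ?N) \<omega>) else 0) \<and> summable (\<lambda>n. norm (?f n))"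
  proof (cases "finite ?N")
    case True
    have eq: "\<tau> n \<omega> \<le> ereal s \<and> (\<forall>j>n. ereal s < \<tau> j \<omega>) \<longleftrightarrow> n = Max ?N" for n
      unfolding eq_commute[of n] Max_eq_iff[OF True \<open>?N \<noteq> {}\<close>] 
      unfolding mem_Collect_eq Ball_def not_le[symmetric] by blast
    have "?f sums G (h (Max ?N) \<omega>)"
      unfolding eq using sums_single[of "Max ?N" "\<lambda>n. G (h n \<omega>)"] by simp
    moreover have "summable (\<lambda>n. norm (?f n))"
      unfolding eq by (rule summable_finite[of "{Max ?N}"]) auto
    ultimately show ?thesis using True by (simp add: path_val_def sums_iff)
  next
    case False
    have "\<not> (\<forall>j>n. ereal s < \<tau> j \<omega>)" for n
    proof
      assume "\<forall>j>n. ereal s < \<tau> j \<omega>"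
      then have "?N \<subseteq> {..n}" by (auto simp: not_le[symmetric])
      then show False using False finite_subset by blast
    qed
    then have f0: "?f = (\<lambda>_. 0)" by (auto simp: fun_eq_iff)
    have "summable (\<lambda>n. norm (?f n))"
      by (rule summable_finite[of "{}"]) (use fun_cong[OF f0] in auto)
    moreover have "path_val G s \<omega> = 0" unfolding path_val_def f0 by simp
    ultimately show ?thesis using False by simp
  qed
  then show "path_val G s \<omega> = (if finite ?N then G (h (Max ?N) \<omega>) else 0)"
    and "summable (\<lambda>n. norm (?f n))" by auto
qed

lemma G_h_measurable [measurable]: "(\<lambda>\<omega>. G (h n \<omega>)) \<in> borel_measurable M"
  for G :: "'b \<Rightarrow> real"
  by (rule measurable_compose[OF h_measurable]) simp

lemma path_val_measurable [measurable]:
  "(\<lambda>(s, \<omega>). path_val G s \<omega>) \<in> borel_measurable (lborel \<Otimes>\<^sub>M M)"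
  unfolding path_val_def by measurable

text \<open>The jump times increase almost everywhere, so the demand on all later jumps reduces to
  the next one. The integrand then is a finite combination of indicators of the events in
  \<open>occ_eq\<close>.\<close>

lemma
  assumes s: "0 \<le> s"
  shows integrable_term: "integrable M (\<lambda>\<omega>. if \<tau> n \<omega> \<le> ereal s \<and> (\<forall>j>n. ereal s < \<tau> j \<omega>) then G (h n \<omega>) else 0)"
      (is "integrable M ?f")
    and integral_term: "(\<integral>\<omega>. (if \<tau> n \<omega> \<le> ereal s \<and> (\<forall>j>n. ereal s < \<tau> j \<omega>) then G (h n \<omega>) else 0) \<partial>M) = EP n G s"
proof -
  let ?B = "\<lambda>g. {\<omega> \<in> space M. h n \<omega> = g \<and> \<tau> n \<omega> \<le> ereal s \<and> ereal s < \<tau> (Suc n) \<omega>}"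
  let ?g = "\<lambda>\<omega>. \<Sum>g\<in>S n. G g * indicator (?B g) \<omega>"
  have ae: "AE \<omega> in M. ?g \<omega> = ?f \<omega>"
    using AE_h_in_S[of n] AE_space AE_xi_pos
  proof eventually_elim
    case (elim \<omega>)
    have "ereal s < \<tau> j \<omega>" if "ereal s < \<tau> (Suc n) \<omega>" "n < j" for j
      using less_le_trans[OF that(1) \<tau>_mono[OF elim(3)]] that(2) by simp
    then have "(\<forall>j>n. ereal s < \<tau> j \<omega>) \<longleftrightarrow> ereal s < \<tau> (Suc n) \<omega>" by auto
    then have "?g \<omega> = (\<Sum>g\<in>S n. if g = h n \<omega> then ?f \<omega> else 0)"
      using elim by (intro sum.cong) (auto simp: indicator_def)
    then show ?case using elim by simp
  qed
  have int: "integrable M ?g" by (intro Bochner_Integration.integrable_sum integrable_mult_right integrable_real_indicator)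
       (auto simp: less_top[symmetric])
  show "integrable M ?f"
    by (rule integrable_cong_AE_imp[OF int _ ae]) measurable
  have "(\<integral>\<omega>. ?f \<omega> \<partial>M) = (\<integral>\<omega>. ?g \<omega> \<partial>M)"
    by (rule integral_cong_AE[OF _ _ ae, symmetric]) measurable
  also have "\<dots> = (\<Sum>g\<in>S n. G g * measure M (?B g))"
    using sets.sets_into_space
    by (subst Bochner_Integration.integral_sum)
       (auto simp: less_top[symmetric] Int_absorb2 intro!: integrable_mult_right integrable_real_indicator)
  also have "\<dots> = EP n G s" by (simp add: EP_def occ_eq s)
  finally show "(\<integral>\<omega>. ?f \<omega> \<partial>M) = EP n G s" .
qed

lemma dominated_abs: "dominated C G \<Longrightarrow> dominated C (\<lambda>g. \<bar>G g\<bar>)"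
  by (simp add: dominated_def)

lemma
  assumes G: "dominated C G" and s: "0 \<le> s"
  shows integrable_path_val: "integrable M (path_val G s)"
    and integral_path_val: "(\<integral>\<omega>. path_val G s \<omega> \<partial>M) = expect G s"
proof -
  let ?f = "\<lambda>n \<omega>. if \<tau> n \<omega> \<le> ereal s \<and> (\<forall>j>n. ereal s < \<tau> j \<omega>) then G (h n \<omega>) else 0"
  have 1: "AE \<omega> in M. summable (\<lambda>n. norm (?f n \<omega>))"
    using path_terms_summable[OF s] by simp
  have "norm (?f n \<omega>) = (if \<tau> n \<omega> \<le> ereal s \<and> (\<forall>j>n. ereal s < \<tau> j \<omega>) then \<bar>G (h n \<omega>)\<bar> else 0)" for n \<omega>
    by auto
  then have "(\<integral>\<omega>. norm (?f n \<omega>) \<partial>M) = EP n (\<lambda>g. \<bar>G g\<bar>) s" for n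
    using integral_term[OF s, of n "\<lambda>g. \<bar>G g\<bar>"] by simp
  then have 2: "summable (\<lambda>n. \<integral>\<omega>. norm (?f n \<omega>) \<partial>M)"
    using summable_EP[OF dominated_abs[OF G] s] by simp
  show "integrable M (path_val G s)"
    unfolding path_val_def[abs_def] by (rule integrable_suminf[OF integrable_term[OF s] 1 2])
  show "(\<integral>\<omega>. path_val G s \<omega> \<partial>M) = expect G s"
    unfolding path_val_def expect_def integral_suminf[OF integrable_term[OF s] 1 2] integral_term[OF s] ..
qed

lemma abs_expect_le:
  assumes "dominated C G" "0 \<le> s"
  shows "\<bar>expect G s\<bar> \<le> C * moment s"
  by (rule LIMSEQ_le_const2[OF tendsto_rabs[OF expect_LIMSEQ[OF assms]]])
     (use abs_sum_EP_le[OF assms] in auto)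

text \<open>Fubini. At most one term of the series is nonzero, so absolute values pass inside
  \<open>path_val\<close>, and absolute integrability becomes a bound on \<open>expect\<close> of
  \<open>\<bar>G\<bar>\<close>.\<close>

lemma integral_path_integral:
  assumes G: "dominated C G" and t: "0 \<le> t"
  shows "(\<integral>\<omega>. (LBINT s:{0..t}. path_val G s \<omega>) \<partial>M) = integral {0..t} (expect G)"
proof -
  interpret P: pair_sigma_finite lborel M
    by (intro pair_sigma_finite.intro lborel.sigma_finite_measure_axioms sigma_finite_measure_axioms)
  have C: "0 \<le> C" using G by (simp add: dominated_def)
  let ?f = "\<lambda>s \<omega>. indicator {0..t} s *\<^sub>R path_val G s \<omega>"
  have f[measurable]: "case_prod ?f \<in> borel_measurable (lborel \<Otimes>\<^sub>M M)" by measurable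
  have abs: "(\<integral>\<omega>. norm (path_val G s \<omega>) \<partial>M) = expect (\<lambda>g. \<bar>G g\<bar>) s" if "0 \<le> s" for s
  proof -
    have "(\<integral>\<omega>. norm (path_val G s \<omega>) \<partial>M) = (\<integral>\<omega>. path_val (\<lambda>g. \<bar>G g\<bar>) s \<omega> \<partial>M)"
    proof (rule integral_cong_AE)
      show "AE \<omega> in M. norm (path_val G s \<omega>) = path_val (\<lambda>g. \<bar>G g\<bar>) s \<omega>"
        by (simp add: path_val_eq that)
    qed (use integrable_path_val[OF G that] integrable_path_val[OF dominated_abs[OF G] that] in auto)
    also have "\<dots> = expect (\<lambda>g. \<bar>G g\<bar>) s" by (rule integral_path_val[OF dominated_abs[OF G] that])
    finally show ?thesis .
  qed
  have int: "integrable (lborel \<Otimes>\<^sub>M M) (case_prod ?f)"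
  proof (rule P.Fubini_integrable[OF f])
    show "integrable lborel (\<lambda>s. \<integral>\<omega>. norm (case (s, \<omega>) of (s, \<omega>) \<Rightarrow> ?f s \<omega>) \<partial>M)"
    proof (rule Bochner_Integration.integrable_bound[where f="\<lambda>s. indicator {0..t} s * (C * moment t)"])
      show "integrable lborel (\<lambda>s. indicator {0..t} s * (C * moment t))"
        by (intro integrable_mult_left integrable_real_indicator) (auto simp: t)
      show "AE s in lborel. norm (\<integral>\<omega>. norm (case (s, \<omega>) of (s, \<omega>) \<Rightarrow> ?f s \<omega>) \<partial>M) \<le> norm (indicator {0..t} s * (C * moment t))"
      proof (rule AE_I2)
        fix s
        show "norm (\<integral>\<omega>. norm (case (s, \<omega>) of (s, \<omega>) \<Rightarrow> ?f s \<omega>) \<partial>M) \<le> norm (indicator {0..t} s * (C * moment t))"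
        proof (cases "s \<in> {0..t}")
          case True
          have "\<bar>expect (\<lambda>g. \<bar>G g\<bar>) s\<bar> \<le> C * moment s"
            using True by (intro abs_expect_le dominated_abs G) auto
          also have "\<dots> \<le> C * moment t" using True C by (intro mult_left_mono moment_mono) auto
          finally show ?thesis using True abs[of s] C moment_nonneg[of t] by simp
        qed simp
      qed
    qed measurable
    show "AE s in lborel. integrable M (\<lambda>\<omega>. case (s, \<omega>) of (s, \<omega>) \<Rightarrow> ?f s \<omega>)"
    proof (rule AE_I2)
      fix s :: real
      show "integrable M (\<lambda>\<omega>. case (s, \<omega>) of (s, \<omega>) \<Rightarrow> ?f s \<omega>)"
        using integrable_path_val[OF G, of s] by (cases "s \<in> {0..t}") auto
    qed
  qed
  have inner: "(\<integral>\<omega>. ?f s \<omega> \<partial>M) = indicator {0..t} s *\<^sub>R expect G s" for s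
    using integral_path_val[OF G, of s] by (cases "s \<in> {0..t}") auto
  have "(\<integral>\<omega>. (LBINT s:{0..t}. path_val G s \<omega>) \<partial>M) = (\<integral>s. (\<integral>\<omega>. ?f s \<omega> \<partial>M) \<partial>lborel)"
    unfolding set_lebesgue_integral_def by (rule P.Fubini_integral[OF int])
  also have "\<dots> = (LBINT s:{0..t}. expect G s)"
    unfolding set_lebesgue_integral_def inner ..
  also have "\<dots> = integral {0..t} (expect G)"
  proof (rule set_borel_integral_eq_integral)
    show "set_integrable lborel {0..t} (expect G)"
      using P.integrable_fst[OF int] unfolding set_integrable_def inner by simp
  qed
  finally show ?thesis .
qed

text \<open>By Dynkin's formula \<open>expect G\<close> is a constant plus an indefinite integral,
  so mere integrability of \<open>expect LG\<close> upgrades to continuity of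
  \<open>expect G\<close>. Integrals of \<open>expect G\<close> thereby become
  differentiable.\<close>

lemma expect_continuous:
  assumes G: "dominated C G" and LG: "dominated C' LG"
    and L: "\<And>n g. g \<in> S n \<Longrightarrow> q g * (avg n G g - G g) = LG g"
  shows "continuous_on {0..} (expect G)"
proof -
  have "continuous_on {0..<b} (expect G)" for b
  proof (cases "0 \<le> b")
    case True
    have "continuous_on {0..b} (\<lambda>t. G f0 + integral {0..t} (expect LG))"
      by (intro continuous_intros indefinite_integral_continuous_1 expect_integrable[OF LG] True)
    then have "continuous_on {0..b} (expect G)"
      by (rule continuous_on_eq) (use dynkin[OF G LG _ L] in auto)
    then show ?thesis by (rule continuous_on_subset) auto
  qed simp
  moreover have "at t within {0..<t+1} = at t within {0..}" if "0 \<le> t" for t :: real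
    by (rule at_within_nhd[of _ "{..<t+1}"]) (use that in auto)
  ultimately show ?thesis
    unfolding continuous_on_eq_continuous_within continuous_within
    by (metis atLeastLessThan_iff atLeast_iff less_add_one)
qed

lemma expect_cmult: "dominated C G \<Longrightarrow> 0 \<le> t \<Longrightarrow> expect (\<lambda>g. a * G g) t = a * expect G t"
  unfolding expect_def EP_cmult by (intro suminf_mult summable_EP)

lemma expect_diff:
  "dominated C G \<Longrightarrow> dominated C' G' \<Longrightarrow> 0 \<le> t \<Longrightarrow> expect (\<lambda>g. G g - G' g) t = expect G t - expect G' t"
  unfolding expect_def EP_diff by (intro suminf_diff[symmetric] summable_EP)

lemma expect_sum:
  "(\<And>i. i \<in> A \<Longrightarrow> dominated (C i) (G i)) \<Longrightarrow> 0 \<le> t \<Longrightarrow>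
    expect (\<lambda>g. \<Sum>i\<in>A. G i g) t = (\<Sum>i\<in>A. expect (G i) t)"
  unfolding expect_def EP_sum by (intro suminf_sum summable_EP)

lemma dominated_cmult: "dominated C G \<Longrightarrow> dominated (\<bar>a\<bar> * C) (\<lambda>g. a * G g)"
  by (auto simp: dominated_def abs_mult mult.assoc intro!: mult_left_mono)

lemma dominated_diff:
  assumes "dominated C G" "dominated C' G'"
  shows "dominated (C + C') (\<lambda>g. G g - G' g)"
  unfolding dominated_def
proof (intro conjI allI ballI)
  fix n g assume "g \<in> S n"
  then have "\<bar>G g\<bar> \<le> C * W g" "\<bar>G' g\<bar> \<le> C' * W g" using assms by (auto simp: dominated_def)
  then show "\<bar>G g - G' g\<bar> \<le> (C + C') * W g" unfolding distrib_right by linarith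
qed (use assms in \<open>auto simp: dominated_def\<close>)

lemma dominated_sum:
  assumes "\<And>i. i \<in> A \<Longrightarrow> dominated (C i) (G i)"
  shows "dominated (\<Sum>i\<in>A. C i) (\<lambda>g. \<Sum>i\<in>A. G i g)"
  unfolding dominated_def sum_distrib_right
  using assms by (auto simp: dominated_def intro!: sum_nonneg order_trans[OF sum_abs] sum_mono)

end

section \<open>The interacting particle system\<close>

lemma other_pair:
  assumes "a \<noteq> b"
  shows "other {a, b} a = b" "other {a, b} b = a"
  unfolding other_def using assms by (auto intro!: the_equality)

lemma norm_edir: "x \<noteq> y \<Longrightarrow> norm (edir x y) = 1"
  by (simp add: edir_def norm_sgn)

lemma inner_edir_self: "x \<noteq> y \<Longrightarrow> edir x y \<bullet> edir x y = 1"
  by (simp add: norm_edir flip: power2_norm_eq_inner)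

lemma edir_swap: "edir y x = - edir x y"
  unfolding edir_def by (metis minus_diff_eq sgn_minus)

text \<open>For an edge event, \<open>norm v\<close> is the factor in the rate and the sign is the
  jump; their product is the signed component, linear in \<open>v\<close>.\<close>

lemma norm_mult_sgn_inner:
  fixes v :: "'a::real_inner"
  assumes "v = c *\<^sub>R d" and "norm d = 1"
  shows "norm v * sgn (v \<bullet> d) = v \<bullet> d"
proof -
  have "d \<bullet> d = 1" using assms(2) by (simp flip: power2_norm_eq_inner)
  then show ?thesis using assms by (simp add: mult.commute[of _ "sgn _"] sgn_mult_abs)
qed

text \<open>Covers both kinds of jumps: a node event changes the values on the edges at that node,
  an edge event those at its two ends, and no norm grows by more than one.\<close>

lemma support_norm_sum_le:
  fixes f f' :: "'b \<Rightarrow> 'c::real_normed_vector"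
  assumes f: "finite {x. f x \<noteq> 0}" and B: "finite B"
    and eq: "\<And>x. x \<notin> B \<Longrightarrow> f' x = f x" and le: "\<And>x. x \<in> B \<Longrightarrow> norm (f' x) \<le> norm (f x) + 1"
  shows "finite {x. f' x \<noteq> 0}"
    and "(\<Sum>x | f' x \<noteq> 0. norm (f' x)) \<le> (\<Sum>x | f x \<noteq> 0. norm (f x)) + real (card B)"
proof -
  let ?A = "{x. f x \<noteq> 0} \<union> B"
  have sub: "{x. f' x \<noteq> 0} \<subseteq> ?A" using eq by auto
  have fin: "finite ?A" using f B by simp
  show "finite {x. f' x \<noteq> 0}" using finite_subset[OF sub fin] .
  have "(\<Sum>x | f' x \<noteq> 0. norm (f' x)) = (\<Sum>x\<in>?A. norm (f' x))"
    using sub fin by (intro sum.mono_neutral_left) auto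
  also have "\<dots> \<le> (\<Sum>x\<in>?A. norm (f x) + (if x \<in> B then 1 else 0))"
    using eq le by (intro sum_mono) auto
  also have "\<dots> = (\<Sum>x\<in>?A. norm (f x)) + real (card (?A \<inter> B))"
    using fin by (simp add: sum.distrib flip: sum.inter_restrict)
  also have "?A \<inter> B = B" by auto
  also have "(\<Sum>x\<in>?A. norm (f x)) = (\<Sum>x | f x \<noteq> 0. norm (f x))"
    using fin by (intro sum.mono_neutral_right) auto
  finally show "(\<Sum>x | f' x \<noteq> 0. norm (f' x)) \<le> (\<Sum>x | f x \<noteq> 0. norm (f x)) + real (card B)" .
qed

definition weight :: "'a::real_normed_vector gfun \<Rightarrow> real" where
  "weight g = 1 + (\<Sum>x | fst g x \<noteq> 0. \<bar>fst g x\<bar>) + (\<Sum>e | snd g e \<noteq> 0. norm (snd g e))"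

text \<open>The invariant carried along the jumps: finite support makes the rate sums finite, and
  \<open>in_F\<close> keeps edge values parallel to their edges, as the drift computations
  require.\<close>

definition fin_state :: "'a::real_normed_vector set \<Rightarrow> 'a set set \<Rightarrow> 'a gfun \<Rightarrow> bool" where
  "fin_state V E g \<longleftrightarrow> in_F V E g \<and> finite {x. fst g x \<noteq> 0} \<and> finite {e. snd g e \<noteq> 0}"

lemma weight_ge_1: "1 \<le> weight g"
  unfolding weight_def by (smt (verit) norm_ge_zero sum_nonneg abs_ge_zero)

lemma abs_fst_le_weight:
  assumes "fin_state V E g"
  shows "\<bar>fst g x\<bar> \<le> weight g"
proof (cases "fst g x = 0")
  case False
  then have "\<bar>fst g x\<bar> \<le> (\<Sum>x | fst g x \<noteq> 0. \<bar>fst g x\<bar>)"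
    using assms by (intro member_le_sum) (auto simp: fin_state_def)
  moreover have "0 \<le> (\<Sum>e | snd g e \<noteq> 0. norm (snd g e))" by (intro sum_nonneg) auto
  ultimately show ?thesis by (simp add: weight_def)
qed (use weight_ge_1[of g] in auto)

lemma norm_snd_le_weight:
  assumes "fin_state V E g"
  shows "norm (snd g e) \<le> weight g"
proof (cases "snd g e = 0")
  case False
  then have "norm (snd g e) \<le> (\<Sum>e | snd g e \<noteq> 0. norm (snd g e))"
    using assms by (intro member_le_sum) (auto simp: fin_state_def)
  moreover have "0 \<le> (\<Sum>x | fst g x \<noteq> 0. \<bar>fst g x\<bar>)" by (intro sum_nonneg) auto
  ultimately show ?thesis unfolding weight_def by linarith
qed (use weight_ge_1[of g] in auto)

lemma edge_multiple:
  "fin_state V E g \<Longrightarrow> {x, y} \<in> E \<Longrightarrow> \<exists>c. snd g {x, y} = c *\<^sub>R (y - x)"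
  unfolding fin_state_def in_F_def by blast

text \<open>Everything is referred to the orientation from \<open>x\<close> to \<open>y\<close>; an
  event at \<open>x\<close> pushes along \<open>edir y x\<close>, hence the minus sign.\<close>

lemma snd_node_jump_diff:
  assumes "x \<noteq> y" "{x, y} \<in> E"
  shows "snd (node_jump E g w) {x, y} = snd g {x, y} +
    (if w = x then - sgn (fst g x) else if w = y then sgn (fst g y) else 0) *\<^sub>R edir x y"
  using assms by (auto simp: node_jump_def other_pair edir_swap[of y x])

locale ips_graph =
  fixes V :: "'a::real_inner set" and E :: "'a set set" and k :: "'a \<Rightarrow> 'a \<Rightarrow> real"
    and m :: "'a \<Rightarrow> real" and V0 V1 :: "'a set"
  assumes ok: "graph_ok V E k m V0 V1"
begin

section \<open>Rates and the effect of a single jump\<close>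

lemma edgeE:
  assumes "e \<in> E"
  obtains x y where "x \<in> V" "y \<in> V" "x \<noteq> y" "e = {x, y}"
  using assms ok unfolding graph_ok_def by meson

lemma edge_props: "{x, y} \<in> E \<Longrightarrow> x \<in> V \<and> y \<in> V \<and> x \<noteq> y"
  by (erule edgeE) (auto simp: doubleton_eq_iff)

lemma k_sym: "k x y = k y x" and k_nonneg: "0 \<le> k x y" and m_pos: "x \<in> V \<Longrightarrow> 0 < m x"
  and finite_nbrs: "x \<in> V \<Longrightarrow> finite (nbrs E x)" and V0_V1: "V0 \<inter> V1 = {}" "V0 \<union> V1 = V"
  using ok unfolding graph_ok_def by auto

lemma ek_pair:
  assumes "x \<noteq> y"
  shows "ek k {x, y} = k x y"
  unfolding ek_def
proof (rule the_equality)
  fix r assume "\<exists>x' y'. {x, y} = {x', y'} \<and> x' \<noteq> y' \<and> r = k x' y'"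
  then show "r = k x y" using k_sym[of x y] by (auto simp: doubleton_eq_iff)
qed (use assms in blast)

lemma ek_nonneg: "e \<in> E \<Longrightarrow> 0 \<le> ek k e"
  by (erule edgeE) (simp add: ek_pair k_nonneg)

lemma node_rate_nonneg: "0 \<le> node_rate V m g x"
  using m_pos[of x] by (auto simp: node_rate_def intro!: divide_nonneg_pos)

lemma edge_rate_nonneg: "0 \<le> edge_rate E k g e"
  using ek_nonneg[of e] by (simp add: edge_rate_def)

lemma total_rate_nonneg: "0 \<le> total_rate V E k m g"
  unfolding total_rate_def by (intro add_nonneg_nonneg sum_nonneg node_rate_nonneg edge_rate_nonneg)

lemma jump_prob_nonneg: "0 \<le> jump_prob V E k m V0 g g'"
  unfolding jump_prob_def using total_rate_nonneg[of g]
  by (auto intro!: divide_nonneg_nonneg add_nonneg_nonneg sum_nonneg node_rate_nonneg edge_rate_nonneg)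

lemma rate_bound:
  obtains K where "0 \<le> K" "\<And>g. fin_state V E g \<Longrightarrow> total_rate V E k m g \<le> K * weight g"
proof -
  from ok obtain B where B: "\<And>x. x \<in> V \<Longrightarrow> 1 / m x \<le> B" "\<And>x y. {x, y} \<in> E \<Longrightarrow> k x y \<le> B"
    unfolding graph_ok_def by metis
  \<comment> \<open>\<open>B\<close> may be negative when the graph has no nodes.\<close>
  define K where "K = max B 0"
  have ek: "ek k e \<le> K" if e: "e \<in> E" for e
  proof -
    obtain x y where "x \<noteq> y" "e = {x, y}" using edgeE[OF e] by metis
    then show ?thesis using B(2)[of x y] e by (simp add: ek_pair K_def le_max_iff_disj)
  qed
  have m: "1 / m x \<le> K" if "x \<in> V" for x
    using B(1)[OF that] by (auto simp: K_def)
  have "total_rate V E k m g \<le> K * weight g" if g: "fin_state V E g" for g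
  proof -
    have sets: "{x \<in> V. fst g x \<noteq> 0} = {x. fst g x \<noteq> 0}" "{e \<in> E. snd g e \<noteq> 0} = {e. snd g e \<noteq> 0}"
      using g by (auto simp: fin_state_def in_F_def)
    have "total_rate V E k m g \<le> (\<Sum>x | fst g x \<noteq> 0. K * \<bar>fst g x\<bar>) + (\<Sum>e | snd g e \<noteq> 0. K * norm (snd g e))"
      unfolding total_rate_def sets
    proof (intro add_mono sum_mono)
      fix x assume "x \<in> {x. fst g x \<noteq> 0}"
      then have "x \<in> V" using sets(1) by blast
      then show "node_rate V m g x \<le> K * \<bar>fst g x\<bar>"
        using mult_right_mono[OF m, of x "\<bar>fst g x\<bar>"] by (simp add: node_rate_def)
    next
      fix e assume "e \<in> {e. snd g e \<noteq> 0}"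
      then have "e \<in> E" using sets(2) by blast
      then show "edge_rate E k g e \<le> K * norm (snd g e)"
        using ek by (auto simp: edge_rate_def intro!: mult_right_mono)
    qed
    also have "\<dots> \<le> K * weight g"
      by (simp add: weight_def K_def distrib_left flip: sum_distrib_left)
    finally show ?thesis .
  qed
  moreover have "0 \<le> K" by (simp add: K_def)
  ultimately show ?thesis using that by blast
qed

lemma edges_at: "{e \<in> E. x \<in> e} = (\<lambda>y. {x, y}) ` nbrs E x"
proof
  show "{e \<in> E. x \<in> e} \<subseteq> (\<lambda>y. {x, y}) ` nbrs E x"
  proof
    fix e assume e: "e \<in> {e \<in> E. x \<in> e}"
    then obtain a b where ab: "e = {a, b}" by (auto elim: edgeE)
    with e have "e = {x, if x = a then b else a}" by auto
    with e show "e \<in> (\<lambda>y. {x, y}) ` nbrs E x" unfolding nbrs_def by blast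
  qed
qed (auto simp: nbrs_def)

lemma inj_on_pair: "inj_on (\<lambda>y. {x, y}) (nbrs E x)"
  by (auto simp: inj_on_def doubleton_eq_iff)

lemma
  assumes g: "fin_state V E g" and x: "x \<in> V"
  shows fin_state_node_jump: "fin_state V E (node_jump E g x)"
    and weight_node_jump: "weight (node_jump E g x) \<le> weight g + real (card (nbrs E x))"
proof -
  let ?g = "node_jump E g x" and ?B = "{e \<in> E. x \<in> e}"
  have fin: "finite ?B" and card: "card ?B = card (nbrs E x)"
    unfolding edges_at using finite_nbrs[OF x] card_image[OF inj_on_pair] by auto
  have le: "norm (snd ?g e) \<le> norm (snd g e) + 1" for e
  proof -
    have "norm (sgn (fst g x) *\<^sub>R edir (other e x) x) \<le> 1"
      by (simp add: edir_def norm_sgn sgn_real_def)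
    then show ?thesis
      using norm_triangle_ineq[of "snd g e" "sgn (fst g x) *\<^sub>R edir (other e x) x"] 
      by (simp add: node_jump_def)
  qed
  have eq: "snd ?g e = snd g e" if "e \<notin> ?B" for e using that by (auto simp: node_jump_def)
  have finE: "finite {e. snd g e \<noteq> 0}" using g by (simp add: fin_state_def)
  have fst: "fst ?g = fst g" by (simp add: node_jump_def)
  note sup = support_norm_sum_le[OF finE fin eq le]
  show "weight ?g \<le> weight g + real (card (nbrs E x))"
    using sup(2) by (simp add: weight_def fst card)
  have "\<exists>c. snd ?g {a, b} = c *\<^sub>R (b - a)" if ab: "{a, b} \<in> E" for a b
  proof -
    obtain c where c: "snd g {a, b} = c *\<^sub>R (b - a)" using edge_multiple[OF g ab] by blast
    have "a \<noteq> b" using edge_props[OF ab] by simp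
    from snd_node_jump_diff[OF this ab, of g x] show ?thesis
      unfolding c edir_def sgn_div_norm scaleR_scaleR scaleR_add_left[symmetric] by blast
  qed
  then show "fin_state V E ?g"
    using g sup(1) eq unfolding fin_state_def in_F_def fst by auto
qed

lemma
  assumes g: "fin_state V E g" and e: "e \<in> E"
  shows fin_state_edge_jump: "fin_state V E (edge_jump V0 g e)"
    and weight_edge_jump: "weight (edge_jump V0 g e) \<le> weight g + 2"
proof -
  let ?g = "edge_jump V0 g e"
  have fin: "finite e" "card e = 2" using e by (auto elim: edgeE)
  have le: "norm (fst ?g z) \<le> norm (fst g z) + 1" for z
    by (auto simp: edge_jump_def sgn_real_def)
  have eq: "fst ?g z = fst g z" if "z \<notin> e" for z using that by (simp add: edge_jump_def)
  have fin0: "finite {x. fst g x \<noteq> 0}" using g by (simp add: fin_state_def)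
  have snd: "snd ?g = snd g" by (simp add: edge_jump_def)
  note sup = support_norm_sum_le[OF fin0 fin(1) eq le]
  show "weight ?g \<le> weight g + 2"
    using sup(2) by (simp add: weight_def snd fin)
  have "fst ?g z = 0" if "z \<notin> V" for z
    using g that V0_V1 by (auto simp: edge_jump_def fin_state_def in_F_def)
  then show "fin_state V E ?g"
    using g sup(1) unfolding fin_state_def in_F_def snd by auto
qed

section \<open>Reachable states, the embedded chain and its generator\<close>

definition successors :: "'a gfun \<Rightarrow> 'a gfun set" where
  "successors g = node_jump E g ` {x \<in> V. fst g x \<noteq> 0} \<union> edge_jump V0 g ` {e \<in> E. snd g e \<noteq> 0}"

lemma weight_successors:
  obtains c where "0 \<le> c"
    "\<And>g g'. fin_state V E g \<Longrightarrow> g' \<in> successors g \<Longrightarrow> weight g' \<le> weight g + c"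
proof -
  from ok obtain d0 :: nat where d0: "\<And>x. x \<in> V \<Longrightarrow> card (nbrs E x) \<le> d0"
    unfolding graph_ok_def by metis
  \<comment> \<open>A node event changes at most \<open>d0\<close> edge values, an edge event at
    most two node values.\<close>
  have "weight g' \<le> weight g + (real d0 + 2)" if g: "fin_state V E g" and g': "g' \<in> successors g" for g g'
    using g' unfolding successors_def
  proof (elim UnE imageE)
    fix x assume "g' = node_jump E g x" "x \<in> {x \<in> V. fst g x \<noteq> 0}"
    then show ?thesis using weight_node_jump[OF g, of x] d0[of x] by auto
  next
    fix e assume "g' = edge_jump V0 g e" "e \<in> {e \<in> E. snd g e \<noteq> 0}"
    then show ?thesis using weight_edge_jump[OF g, of e] by auto
  qed
  then show ?thesis using that[of "real d0 + 2"] by auto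
qed

lemma fin_state_successors: "fin_state V E g \<Longrightarrow> g' \<in> successors g \<Longrightarrow> fin_state V E g'"
  unfolding successors_def using fin_state_node_jump fin_state_edge_jump by blast

lemma finite_successors: "fin_state V E g \<Longrightarrow> finite (successors g)"
  unfolding successors_def fin_state_def by (auto intro: finite_subset)

text \<open>The alternative \<open>g' = g\<close> covers absorbing states, where the chain stays put
  with probability one.\<close>

lemma jump_prob_support:
  assumes "jump_prob V E k m V0 g g' \<noteq> 0"
  shows "g' = g \<or> g' \<in> successors g"
proof (rule ccontr)
  assume "\<not> ?thesis"
  then have 1: "g' \<noteq> g" and 2: "{x \<in> V. fst g x \<noteq> 0 \<and> node_jump E g x = g'} = {}"
    "{e \<in> E. snd g e \<noteq> 0 \<and> edge_jump V0 g e = g'} = {}"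
    unfolding successors_def by blast+
  show False using assms unfolding jump_prob_def 2 using 1 by (simp split: if_splits)
qed

text \<open>The generator as a sum over events instead of target states: different nodes or edges
  may lead to the same state, and their rates then add up.\<close>

definition drift :: "('a gfun \<Rightarrow> real) \<Rightarrow> 'a gfun \<Rightarrow> real" where
  "drift G g = (\<Sum>x\<in>{x \<in> V. fst g x \<noteq> 0}. node_rate V m g x * (G (node_jump E g x) - G g))
     + (\<Sum>e\<in>{e \<in> E. snd g e \<noteq> 0}. edge_rate E k g e * (G (edge_jump V0 g e) - G g))"

text \<open>\<open>sum.group\<close> collects the events by target state. If the total rate is zero
  then so is every single rate, and both sides vanish although \<open>jump_prob\<close> is then an
  artificial self-loop.\<close>

lemma drift_eq:
  assumes g: "fin_state V E g" and T: "finite T" "successors g \<subseteq> T"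
  shows "total_rate V E k m g * ((\<Sum>g'\<in>T. jump_prob V E k m V0 g g' * G g') - G g) = drift G g"
proof -
  let ?A = "{x \<in> V. fst g x \<noteq> 0}" and ?B = "{e \<in> E. snd g e \<noteq> 0}"
  let ?q = "total_rate V E k m g"
  have fin: "finite ?A" "finite ?B" using g by (auto simp: fin_state_def)
  show ?thesis
  proof (cases "?q = 0")
    case True
    then have "(\<Sum>x\<in>?A. node_rate V m g x) = 0" "(\<Sum>e\<in>?B. edge_rate E k g e) = 0"
      unfolding total_rate_def
      using sum_nonneg[of ?A "node_rate V m g"] sum_nonneg[of ?B "edge_rate E k g"]
        node_rate_nonneg edge_rate_nonneg by (smt (verit))+
    then have "\<forall>x\<in>?A. node_rate V m g x = 0" "\<forall>e\<in>?B. edge_rate E k g e = 0"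
      using sum_nonneg_eq_0_iff[OF fin(1), of "node_rate V m g"]
        sum_nonneg_eq_0_iff[OF fin(2), of "edge_rate E k g"] node_rate_nonneg edge_rate_nonneg by simp_all
    then show ?thesis using True unfolding drift_def by simp
  next
    case False
    have p: "?q * (jump_prob V E k m V0 g g' * G g') =
      (\<Sum>x\<in>{x \<in> ?A. node_jump E g x = g'}. node_rate V m g x * G (node_jump E g x)) +
      (\<Sum>e\<in>{e \<in> ?B. edge_jump V0 g e = g'}. edge_rate E k g e * G (edge_jump V0 g e))" for g'
    proof -
      have "?q * (jump_prob V E k m V0 g g' * G g') =
        (\<Sum>x\<in>{x \<in> ?A. node_jump E g x = g'}. node_rate V m g x) * G g' +
        (\<Sum>e\<in>{e \<in> ?B. edge_jump V0 g e = g'}. edge_rate E k g e) * G g'"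
        using False by (simp add: jump_prob_def conj_assoc distrib_right)
      then show ?thesis by (simp add: sum_distrib_right)
    qed
    have "?q * (\<Sum>g'\<in>T. jump_prob V E k m V0 g g' * G g') =
      (\<Sum>x\<in>?A. node_rate V m g x * G (node_jump E g x)) + (\<Sum>e\<in>?B. edge_rate E k g e * G (edge_jump V0 g e))"
      unfolding sum_distrib_left p sum.distrib
      using T(2) by (subst (1 2) sum.group[OF _ T(1)]) (auto simp: fin successors_def)
    then show ?thesis
      by (simp add: drift_def right_diff_distrib sum_subtractf total_rate_def distrib_right sum_distrib_right)
  qed
qed

text \<open>At a nonzero rate this is \<open>drift_eq\<close> for the constant function one, whose
  drift is zero.\<close>

lemma jump_prob_sum:
  assumes g: "fin_state V E g" and T: "finite T" "successors g \<subseteq> T" "g \<in> T"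
  shows "(\<Sum>g'\<in>T. jump_prob V E k m V0 g g') = 1"
proof (cases "total_rate V E k m g = 0")
  case True
  then show ?thesis using T by (simp add: jump_prob_def)
next
  case False
  then show ?thesis using drift_eq[OF g T(1,2), of "\<lambda>_. 1"] by (simp add: drift_def)
qed

text \<open>Keeping the previous level admits the self-loops at absorbing states, so no mass leaves
  the layers.\<close>

primrec level :: "'a gfun \<Rightarrow> nat \<Rightarrow> 'a gfun set" where
  "level f 0 = {f}"
| "level f (Suc n) = level f n \<union> (\<Union>g\<in>level f n. successors g)"

lemma level_fin_state: "fin_state V E f \<Longrightarrow> g \<in> level f n \<Longrightarrow> fin_state V E g"
  by (induction n arbitrary: g) (auto intro: fin_state_successors)

lemma finite_level: "fin_state V E f \<Longrightarrow> finite (level f n)"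
  by (induction n) (auto intro: finite_successors level_fin_state)

lemma drift_node:
  assumes g: "fin_state V E g" and z: "z \<in> V"
  shows "drift (\<lambda>g. fst g z) g =
    (if z \<in> V0 then \<Sum>y\<in>nbrs E z. k z y * (snd g {z, y} \<bullet> edir z y) else 0)"
proof -
  have "drift (\<lambda>g. fst g z) g = (\<Sum>e\<in>{e \<in> E. snd g e \<noteq> 0}. edge_rate E k g e *
     (if z \<in> V0 \<and> z \<in> e then sgn (snd g e \<bullet> edir z (other e z)) else 0))"
    unfolding drift_def by (simp add: node_jump_def edge_jump_def if_distrib[of "\<lambda>x. x - _"] cong: if_cong)
  also have "\<dots> = (if z \<in> V0 then \<Sum>y\<in>nbrs E z. k z y * (snd g {z, y} \<bullet> edir z y) else 0)"
  proof (cases "z \<in> V0")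
    case True
    let ?t = "\<lambda>e. ek k e * (norm (snd g e) * sgn (snd g e \<bullet> edir z (other e z)))"
    have fin: "finite {e \<in> E. z \<in> e}" unfolding edges_at using finite_nbrs[OF z] by simp
    have "(\<Sum>e\<in>{e \<in> E. snd g e \<noteq> 0}. edge_rate E k g e *
       (if z \<in> V0 \<and> z \<in> e then sgn (snd g e \<bullet> edir z (other e z)) else 0)) = (\<Sum>e\<in>{e \<in> E. z \<in> e}. ?t e)"
      \<comment> \<open>The sum passes from the edges with nonzero value to the edges at
        \<open>z\<close>, a set independent of \<open>g\<close>; terms in only one of the two index
        sets are zero.\<close>
      using g True fin by (intro sum.mono_neutral_cong) (auto simp: fin_state_def edge_rate_def)
    also have "\<dots> = (\<Sum>y\<in>nbrs E z. ?t {z, y})"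
      unfolding edges_at by (simp add: sum.reindex[OF inj_on_pair])
    also have "\<dots> = (\<Sum>y\<in>nbrs E z. k z y * (snd g {z, y} \<bullet> edir z y))"
    proof (intro sum.cong refl)
      fix y assume "y \<in> nbrs E z"
      then have y: "{z, y} \<in> E" by (simp add: nbrs_def)
      then have "z \<noteq> y" using edge_props by blast
      obtain c where "snd g {z, y} = c *\<^sub>R (y - z)" using edge_multiple[OF g y] by blast
      then have "snd g {z, y} = (c * norm (y - z)) *\<^sub>R edir z y"
        using \<open>z \<noteq> y\<close> by (simp add: edir_def sgn_div_norm)
      then show "?t {z, y} = k z y * (snd g {z, y} \<bullet> edir z y)"
        using norm_mult_sgn_inner[OF _ norm_edir[OF \<open>z \<noteq> y\<close>]] \<open>z \<noteq> y\<close> by (simp add: ek_pair other_pair)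
    qed
    finally show ?thesis using True by simp
  qed simp
  finally show ?thesis .
qed

text \<open>Edge events leave edge values alone, and among node events only those at the two ends
  count, with opposite signs.\<close>

lemma drift_edge:
  assumes g: "fin_state V E g" and xy: "{x, y} \<in> E"
  shows "drift (\<lambda>g. snd g {x, y} \<bullet> edir x y) g = fst g y / m y - fst g x / m x"
proof -
  have x: "x \<in> V" "y \<in> V" "x \<noteq> y" using edge_props[OF xy] by auto
  let ?t = "\<lambda>w. \<bar>fst g w\<bar> / m w * (if w = x then - sgn (fst g x) else if w = y then sgn (fst g y) else 0)"
  have "drift (\<lambda>g. snd g {x, y} \<bullet> edir x y) g =
    (\<Sum>w\<in>{w \<in> V. fst g w \<noteq> 0}. node_rate V m g w * (if w = x then - sgn (fst g x) else if w = y then sgn (fst g y) else 0))"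
    unfolding drift_def snd_node_jump_diff[OF x(3) xy]
    by (simp add: inner_add_left inner_edir_self[OF x(3)] edge_jump_def)
  also have "\<dots> = (\<Sum>w\<in>{x, y}. ?t w)"
    using g x by (intro sum.mono_neutral_cong) (auto simp: fin_state_def node_rate_def)
  also have "\<dots> = fst g y / m y - fst g x / m x"
    using x(3) by (simp add: abs_mult_sgn)
  finally show ?thesis .
qed

end

text \<open>On explosion \<open>ips_state\<close> is the zero function, whose coordinate agrees with
  the zero value of \<open>path_val\<close>; the two integrands coincide on every path, without an
  exceptional set.\<close>

lemma ips_u_eq:
  assumes "lyapunov_chain M h xi q p S f0 W K c" "0 \<le> t"
    and dom: "lyapunov_chain.dominated S W C (\<lambda>g. fst g x)"
  shows "ips_u \<phi> m M h xi x t = \<phi> x + (1 / m x) *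
    integral {0..t} (lyapunov_chain.expect q p S f0 (\<lambda>g. fst g x))"
proof -
  interpret lyapunov_chain M h xi q p S f0 W K c by fact
  have "(LBINT s:{0..t}. fst (ips_state h xi s \<omega>) x) = (LBINT s:{0..t}. path_val (\<lambda>g. fst g x) s \<omega>)" for \<omega>
    by (intro set_lebesgue_integral_cong) (auto simp: ips_state_def path_val_eq)
  then show ?thesis
    unfolding ips_u_def using integral_path_integral[OF dom assms(2)] by simp
qed

theorem theorem3p1:
  fixes V :: "'a::{real_inner, complete_space} set"
    and E :: "'a set set" and k :: "'a \<Rightarrow> 'a \<Rightarrow> real" and m :: "'a \<Rightarrow> real"
    and V0 V1 :: "'a set"
    and \<phi> \<psi> :: "'a \<Rightarrow> real" and f :: "'a gfun"
    and M :: "'w measure" and h :: "nat \<Rightarrow> 'w \<Rightarrow> 'a gfun" and xi :: "nat \<Rightarrow> 'w \<Rightarrow> ereal"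
  assumes G: "graph_ok V E k m V0 V1"
    and psi_V1: "\<forall>x\<in>V1. \<psi> x = 0"
    and f_node: "\<forall>x\<in>V. fst f x = m x * \<psi> x"
    and f_edge: "\<forall>x y. {x, y} \<in> E \<longrightarrow> snd f {x, y} = (\<phi> y - \<phi> x) *\<^sub>R edir x y"
    and f_F0: "in_F0 V E f"
    and IPS: "ips_realization V E k m V0 M h xi f"
  shows "(\<forall>x\<in>V0. \<exists>u'. (\<forall>t\<ge>0. ((\<lambda>s. ips_u \<phi> m M h xi x s) has_real_derivative u' t) (at t within {0..}))
               \<and> (\<forall>t\<ge>0. (u' has_real_derivative
                     (\<Sum>y\<in>nbrs E x. k x y * (ips_u \<phi> m M h xi y t - ips_u \<phi> m M h xi x t)) / m x)
                     (at t within {0..})))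
       \<and> (\<forall>x\<in>V. ips_u \<phi> m M h xi x 0 = \<phi> x)
       \<and> (\<forall>x\<in>V. ((\<lambda>s. ips_u \<phi> m M h xi x s) has_real_derivative \<psi> x) (at 0 within {0..}))
       \<and> (\<forall>x\<in>V1. \<forall>t\<ge>0. ips_u \<phi> m M h xi x t = \<phi> x)"
proof -
  interpret ips_graph V E k m V0 V1 by unfold_locales (rule G)
  have f: "fin_state V E f" using f_F0 by (simp add: fin_state_def in_F0_def)
  obtain K where K: "0 \<le> K" "\<And>g. fin_state V E g \<Longrightarrow> total_rate V E k m g \<le> K * weight g"
    using rate_bound by metis
  obtain c where c: "0 \<le> c" "\<And>g g'. fin_state V E g \<Longrightarrow> g' \<in> successors g \<Longrightarrow> weight g' \<le> weight g + c"
    using weight_successors by metis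
  note lv = level_fin_state[OF f]
  have chain: "lyapunov_chain M h xi (total_rate V E k m) (jump_prob V E k m V0) (level f) f weight K c"
  proof -
    interpret prob_space M using IPS by (simp add: ips_realization_def)
    show ?thesis
    proof unfold_locales
      show "h n \<in> measurable M (count_space UNIV)" "xi n \<in> borel_measurable M" for n
        using IPS by (auto simp: ips_realization_def)
      show "(\<Sum>g'\<in>level f (Suc n). jump_prob V E k m V0 g g') = 1" if "g \<in> level f n" for n g
        using that by (intro jump_prob_sum lv finite_level[OF f]) auto
      show "measure M {\<omega> \<in> space M. (\<forall>i\<le>n. h i \<omega> = g i) \<and> (\<forall>i\<in>{1..n}. ereal (s i) < xi i \<omega>)}
        = (if g 0 = f then 1 else 0) * (\<Prod>i\<in>{1..n}. jump_prob V E k m V0 (g (i - 1)) (g i) *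
            exp (- total_rate V E k m (g (i - 1)) * s i))" if "\<And>i. 0 \<le> s i" for n g s
        using IPS that unfolding ips_realization_def by blast
      show "weight g' \<le> weight g + c"
        if "g \<in> level f n" "jump_prob V E k m V0 g g' \<noteq> 0" for n g g'
        using jump_prob_support[OF that(2)] c(2)[OF lv[OF that(1)], of g'] c(1) by auto
    qed (use K c total_rate_nonneg jump_prob_nonneg finite_level[OF f] weight_ge_1 lv in auto)
  qed
  interpret L: lyapunov_chain M h xi "total_rate V E k m" "jump_prob V E k m V0" "level f" f weight K c
    by (rule chain)
  have gen: "total_rate V E k m g * (L.avg n F g - F g) = drift F g" if "g \<in> level f n" for n g F
    unfolding L.avg_def using that by (intro drift_eq lv finite_level[OF f]) auto

  let ?X = "\<lambda>x g. fst g x" and ?Y = "\<lambda>x y g. snd g {x, y} \<bullet> edir x y"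
  let ?a = "\<lambda>x. L.expect (?X x)" and ?b = "\<lambda>x y. L.expect (?Y x y)"
  have dX: "L.dominated 1 (?X x)" for x
    using abs_fst_le_weight[OF lv] by (auto simp: L.dominated_def)
  have dY: "L.dominated 1 (?Y x y)" for x y
    unfolding L.dominated_def
  proof (intro conjI allI ballI)
    fix n g assume g: "g \<in> level f n"
    have "\<bar>?Y x y g\<bar> \<le> norm (snd g {x, y}) * norm (edir x y)" by (rule Cauchy_Schwarz_ineq2)
    also have "\<dots> \<le> weight g * 1"
      using norm_snd_le_weight[OF lv[OF g]] weight_ge_1[of g]
      by (intro mult_mono) (auto simp: edir_def norm_sgn)
    finally show "\<bar>?Y x y g\<bar> \<le> 1 * weight g" by simp
  qed simp

  \<comment> \<open>The generator on the coordinates in a form free of the layer; both expressions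
    are linear in the coordinates and so inherit linear growth.\<close>
  define LX where "LX x g = (if x \<in> V0 then \<Sum>y\<in>nbrs E x. k x y * ?Y x y g else 0)" for x and g :: "'a gfun"
  define LY where "LY x y g = 1 / m y * ?X y g - 1 / m x * ?X x g" for x y and g :: "'a gfun"
  have dLX: "L.dominated (\<Sum>y\<in>nbrs E x. \<bar>k x y\<bar> * 1) (LX x)" for x
  proof (cases "x \<in> V0")
    case True
    have "L.dominated (\<Sum>y\<in>nbrs E x. \<bar>k x y\<bar> * 1) (\<lambda>g. \<Sum>y\<in>nbrs E x. k x y * ?Y x y g)"
      by (intro L.dominated_sum L.dominated_cmult dY)
    then show ?thesis using True by (simp add: LX_def[abs_def])
  next
    case False
    have "0 \<le> (\<Sum>y\<in>nbrs E x. \<bar>k x y\<bar> * 1) * weight g" for g :: "'a gfun"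
      using weight_ge_1[of g] by (intro mult_nonneg_nonneg sum_nonneg) auto
    with False show ?thesis by (auto simp: LX_def L.dominated_def intro!: sum_nonneg)
  qed
  have dLY: "L.dominated (\<bar>1 / m y\<bar> * 1 + \<bar>1 / m x\<bar> * 1) (LY x y)" for x y
    unfolding LY_def by (intro L.dominated_diff L.dominated_cmult dX)
  have gX: "total_rate V E k m g * (L.avg n (?X x) g - ?X x g) = LX x g" if "g \<in> level f n" "x \<in> V" for n g x
    using gen[OF that(1), of "?X x"] drift_node[OF lv[OF that(1)] that(2)] by (simp add: LX_def)
  have gY: "total_rate V E k m g * (L.avg n (?Y x y) g - ?Y x y g) = LY x y g"
    if "g \<in> level f n" "{x, y} \<in> E" for n g x y
    using gen[OF that(1), of "?Y x y"] drift_edge[OF lv[OF that(1)] that(2)] by (simp add: LY_def)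

  let ?u = "ips_u \<phi> m M h xi"
  have u: "?u x t = \<phi> x + 1 / m x * integral {0..t} (?a x)" if "0 \<le> t" for x t
    by (rule ips_u_eq[OF chain that dX])
  have a_cont: "continuous_on {0..} (?a x)" if "x \<in> V" for x
    by (rule L.expect_continuous[OF dX dLX gX[OF _ that]])
  have a_eq: "?a x t = fst f x + integral {0..t} (L.expect (LX x))" if "x \<in> V" "0 \<le> t" for x t
    by (rule L.dynkin[OF dX dLX that(2) gX[OF _ that(1)]])
  have b_cont: "continuous_on {0..} (?b x y)" if "{x, y} \<in> E" for x y
    by (rule L.expect_continuous[OF dY dLY gY[OF _ that]])
  \<comment> \<open>\<open>?u x t - \<phi> x\<close> is the time integral of \<open>?a x\<close>
    divided by \<open>m x\<close>, so Dynkin's formula for the edge component yields the difference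
    of \<open>?u\<close>, with initial value \<open>\<phi> y - \<phi> x\<close> by the choice of
    \<open>f\<close>.\<close>
  have b_eq: "?b x y t = ?u y t - ?u x t" if xy: "{x, y} \<in> E" and t: "0 \<le> t" for x y t
  proof -
    have "x \<noteq> y" "x \<in> V" "y \<in> V" using edge_props[OF xy] by auto
    have "?b x y t = ?Y x y f + integral {0..t} (L.expect (LY x y))"
      by (rule L.dynkin[OF dY dLY t gY[OF _ xy]])
    also have "?Y x y f = \<phi> y - \<phi> x"
      using f_edge xy inner_edir_self[OF \<open>x \<noteq> y\<close>] by simp
    also have "integral {0..t} (L.expect (LY x y)) = integral {0..t} (\<lambda>s. 1 / m y * ?a y s - 1 / m x * ?a x s)"
    proof (rule integral_cong)
      fix s assume "s \<in> {0..t}"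
      then have s: "0 \<le> s" by simp
      show "L.expect (LY x y) s = 1 / m y * ?a y s - 1 / m x * ?a x s"
        unfolding LY_def
        by (subst L.expect_diff[OF L.dominated_cmult[OF dX] L.dominated_cmult[OF dX] s])
           (simp only: L.expect_cmult[OF dX s])
    qed
    also have "\<dots> = 1 / m y * integral {0..t} (?a y) - 1 / m x * integral {0..t} (?a x)"
      by (subst Henstock_Kurzweil_Integration.integral_diff)
         (intro integrable_on_mult_right L.expect_integrable[OF dX t] | simp)+
    finally show ?thesis by (simp add: u[OF t])
  qed
  have u_deriv: "(?u x has_real_derivative ?a x t / m x) (at t within {0..})" if x: "x \<in> V" and t: "0 \<le> t" for x t
  proof (rule has_field_derivative_transform_within[where d=1])
    show "((\<lambda>t. \<phi> x + 1 / m x * integral {0..t} (?a x)) has_real_derivative ?a x t / m x) (at t within {0..})"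
      using m_pos[OF x]
      by (auto intro!: derivative_eq_intros integral_has_derivative_Ici[OF a_cont[OF x] t])
  qed (use t u in auto)
  have a_deriv: "((\<lambda>t. ?a x t / m x) has_real_derivative (\<Sum>y\<in>nbrs E x. k x y * (?u y t - ?u x t)) / m x) (at t within {0..})"
    if x: "x \<in> V0" and t: "0 \<le> t" for x t
  proof (rule has_field_derivative_transform_within[where d=1])
    have "x \<in> V" using x V0_V1 by auto
    have LX: "L.expect (LX x) s = (\<Sum>y\<in>nbrs E x. k x y * ?b x y s)" if s: "0 \<le> s" for s
    proof -
      have "L.expect (LX x) s = L.expect (\<lambda>g. \<Sum>y\<in>nbrs E x. k x y * ?Y x y g) s"
        using x by (simp add: LX_def[abs_def])
      also have "\<dots> = (\<Sum>y\<in>nbrs E x. k x y * ?b x y s)"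
        by (subst L.expect_sum[OF L.dominated_cmult[OF dY] s]) (simp only: L.expect_cmult[OF dY s])
      finally show ?thesis .
    qed
    \<comment> \<open>Continuity of the edge expectations makes the integral in Dynkin's formula
      differentiable; \<open>b_eq\<close> then turns its integrand into differences of
      \<open>?u\<close>.\<close>
    have "continuous_on {0..} (\<lambda>s. \<Sum>y\<in>nbrs E x. k x y * ?b x y s)"
      by (intro continuous_intros b_cont) (simp add: nbrs_def)
    then have "continuous_on {0..} (L.expect (LX x))"
      by (rule continuous_on_eq) (simp add: LX)
    from integral_has_derivative_Ici[OF this t] m_pos[OF \<open>x \<in> V\<close>]
    have "((\<lambda>t. (fst f x + integral {0..t} (L.expect (LX x))) / m x) has_real_derivative L.expect (LX x) t / m x) (at t within {0..})"
      by (auto intro!: derivative_eq_intros)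
    also have "L.expect (LX x) t = (\<Sum>y\<in>nbrs E x. k x y * (?u y t - ?u x t))"
      unfolding LX[OF t] by (intro sum.cong refl) (simp add: b_eq[OF _ t] nbrs_def)
    finally show "((\<lambda>t. (fst f x + integral {0..t} (L.expect (LX x))) / m x) has_real_derivative
      (\<Sum>y\<in>nbrs E x. k x y * (?u y t - ?u x t)) / m x) (at t within {0..})" .
    show "(fst f x + integral {0..s} (L.expect (LX x))) / m x = ?a x s / m x" if "s \<in> {0..}" for s
      using a_eq[OF \<open>x \<in> V\<close>, of s] that by simp
  qed (use t in auto)
  show ?thesis
  proof (intro conjI ballI allI impI)
    fix x assume x: "x \<in> V0"
    then have "x \<in> V" using V0_V1 by auto
    show "\<exists>u'. (\<forall>t\<ge>0. ((\<lambda>s. ?u x s) has_real_derivative u' t) (at t within {0..})) \<and>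
       (\<forall>t\<ge>0. (u' has_real_derivative (\<Sum>y\<in>nbrs E x. k x y * (?u y t - ?u x t)) / m x) (at t within {0..}))"
      using u_deriv[OF \<open>x \<in> V\<close>] a_deriv[OF x] by (intro exI[of _ "\<lambda>t. ?a x t / m x"]) auto
  next
    fix x assume "x \<in> V"
    show "?u x 0 = \<phi> x" by (simp add: u)
  next
    fix x assume x: "x \<in> V"
    have "?a x 0 / m x = \<psi> x" using a_eq[OF x, of 0] f_node x m_pos[OF x] by simp
    then show "((\<lambda>s. ?u x s) has_real_derivative \<psi> x) (at 0 within {0..})"
      using u_deriv[OF x, of 0] by simp
  next
    fix x and t :: real assume x: "x \<in> V1" and t: "0 \<le> t"
    have "x \<in> V" "x \<notin> V0" using x V0_V1 by auto
    \<comment> \<open>A node of \<open>V1\<close> has zero drift and starts from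
      \<open>m x * \<psi> x = 0\<close>.\<close>
    have "?a x s = 0" if "s \<in> {0..t}" for s
    proof -
      have "L.expect (LX x) = (\<lambda>_. 0)"
        using \<open>x \<notin> V0\<close> by (simp add: LX_def[abs_def] L.expect_def[abs_def] L.EP_def)
      then show ?thesis using a_eq[OF \<open>x \<in> V\<close>, of s] that f_node psi_V1 x \<open>x \<in> V\<close> by simp
    qed
    then have "integral {0..t} (?a x) = integral {0..t} (\<lambda>_. 0)" by (intro integral_cong)
    then show "?u x t = \<phi> x" by (simp add: u[OF t])
  qed
qed

end
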